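(* Let $F$ be a ring, let $G$ be a finite group, $H$ a subgroup of $G$ and $K$ a subgroup of $H$, and let $A=F[G]$, $B=F[H]$, $C=F[K]$ be the group algebras, forming a tower of rings $C\subseteq B\subseteq A$. If the normal closure $K^G$ of $K$ in $G$ is contained in $H$, then the tower $A\,|\,B\,|\,C$ is depth three (D3), i.e. both right depth three and left depth three.
   Context: Rings have identity. The normal closure $K^G$ is the smallest normal subgroup of $G$ containing $K$. A tower of rings $A\,|\,B\,|\,C$ (unital ring homomorphisms $C\to B\to A$) is right depth three if for some positive integer $N$ the tensor-square $A\otimes_B A$ is isomorphic, as a natural $A$-$C$-bimodule, to a direct summand of $A^N$; it is left depth three if for some positive integer $N$, $A\otimes_B A$ is isomorphic, as a natural $C$-$A$-bimodule, to a direct summand of $A^N$; it is D3 if both hold. *)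

theory Defs
  imports "HOL-Algebra.Algebra"
begin

section \<open>Bimodules over not necessarily commutative rings\<close>

text \<open>The abelian group underlying a bimodule is kept in multiplicative notation, so that
  subgroups, quotients, products and isomorphisms are those of the group theory library.\<close>

record ('r, 's, 'm) bimod = "'m monoid" +
  lact :: "'r \<Rightarrow> 'm \<Rightarrow> 'm"
  ract :: "'m \<Rightarrow> 's \<Rightarrow> 'm"

locale bimodule = R: ring R + S: ring S + M: comm_group M
  for R :: "('r, 'a) ring_scheme" and S :: "('s, 'b) ring_scheme"
    and M :: "('r, 's, 'm, 'c) bimod_scheme" +
  assumes lact_closed: "r \<in> carrier R \<Longrightarrow> x \<in> carrier M \<Longrightarrow> lact M r x \<in> carrier M"
    and lact_mult: "r \<in> carrier R \<Longrightarrow> x \<in> carrier M \<Longrightarrow> y \<in> carrier M \<Longrightarrow>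
      lact M r (x \<otimes>\<^bsub>M\<^esub> y) = lact M r x \<otimes>\<^bsub>M\<^esub> lact M r y"
    and lact_radd: "r \<in> carrier R \<Longrightarrow> r' \<in> carrier R \<Longrightarrow> x \<in> carrier M \<Longrightarrow>
      lact M (r \<oplus>\<^bsub>R\<^esub> r') x = lact M r x \<otimes>\<^bsub>M\<^esub> lact M r' x"
    and lact_rmult: "r \<in> carrier R \<Longrightarrow> r' \<in> carrier R \<Longrightarrow> x \<in> carrier M \<Longrightarrow>
      lact M (r \<otimes>\<^bsub>R\<^esub> r') x = lact M r (lact M r' x)"
    and lact_one: "x \<in> carrier M \<Longrightarrow> lact M \<one>\<^bsub>R\<^esub> x = x"
    and ract_closed: "s \<in> carrier S \<Longrightarrow> x \<in> carrier M \<Longrightarrow> ract M x s \<in> carrier M"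
    and ract_mult: "s \<in> carrier S \<Longrightarrow> x \<in> carrier M \<Longrightarrow> y \<in> carrier M \<Longrightarrow>
      ract M (x \<otimes>\<^bsub>M\<^esub> y) s = ract M x s \<otimes>\<^bsub>M\<^esub> ract M y s"
    and ract_sadd: "s \<in> carrier S \<Longrightarrow> s' \<in> carrier S \<Longrightarrow> x \<in> carrier M \<Longrightarrow>
      ract M x (s \<oplus>\<^bsub>S\<^esub> s') = ract M x s \<otimes>\<^bsub>M\<^esub> ract M x s'"
    and ract_smult: "s \<in> carrier S \<Longrightarrow> s' \<in> carrier S \<Longrightarrow> x \<in> carrier M \<Longrightarrow>
      ract M x (s \<otimes>\<^bsub>S\<^esub> s') = ract M (ract M x s) s'"
    and ract_one: "x \<in> carrier M \<Longrightarrow> ract M x \<one>\<^bsub>S\<^esub> = x"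
    and lact_ract: "r \<in> carrier R \<Longrightarrow> s \<in> carrier S \<Longrightarrow> x \<in> carrier M \<Longrightarrow>
      ract M (lact M r x) s = lact M r (ract M x s)"

definition subbimodule ::
  "('r, 'a) ring_scheme \<Rightarrow> ('s, 'b) ring_scheme \<Rightarrow> 'm set \<Rightarrow> ('r, 's, 'm, 'c) bimod_scheme \<Rightarrow> bool"
  where "subbimodule R S P M \<longleftrightarrow> subgroup P M
    \<and> (\<forall>r\<in>carrier R. \<forall>x\<in>P. lact M r x \<in> P)
    \<and> (\<forall>s\<in>carrier S. \<forall>x\<in>P. ract M x s \<in> P)"

definition direct_summand ::
  "('r, 'a) ring_scheme \<Rightarrow> ('s, 'b) ring_scheme \<Rightarrow> 'm set \<Rightarrow> ('r, 's, 'm, 'c) bimod_scheme \<Rightarrow> bool"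
  where "direct_summand R S P M \<longleftrightarrow> subbimodule R S P M
    \<and> (\<exists>Q. subbimodule R S Q M \<and> P <#>\<^bsub>M\<^esub> Q = carrier M \<and> P \<inter> Q = {\<one>\<^bsub>M\<^esub>})"

definition bimod_iso ::
  "('r, 'a) ring_scheme \<Rightarrow> ('s, 'b) ring_scheme \<Rightarrow>
   ('r, 's, 'm, 'c) bimod_scheme \<Rightarrow> ('r, 's, 'n, 'd) bimod_scheme \<Rightarrow> ('m \<Rightarrow> 'n) set"
  where "bimod_iso R S M N = {h \<in> iso M N.
    (\<forall>r\<in>carrier R. \<forall>x\<in>carrier M. h (lact M r x) = lact N r (h x)) \<and>
    (\<forall>s\<in>carrier S. \<forall>x\<in>carrier M. h (ract M x s) = ract N (h x) s)}"

definition iso_to_direct_summand ::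
  "('r, 'a) ring_scheme \<Rightarrow> ('s, 'b) ring_scheme \<Rightarrow>
   ('r, 's, 'm, 'c) bimod_scheme \<Rightarrow> ('r, 's, 'n, 'd) bimod_scheme \<Rightarrow> bool"
  where "iso_to_direct_summand R S M N \<longleftrightarrow>
    (\<exists>P. direct_summand R S P N \<and> bimod_iso R S M (N\<lparr>carrier := P\<rparr>) \<noteq> {})"

definition power_bimod :: "('r, 's, 'm, 'c) bimod_scheme \<Rightarrow> nat \<Rightarrow> ('r, 's, nat \<Rightarrow> 'm) bimod"
  where "power_bimod M N = monoid.extend (product_group {..<N} (\<lambda>_. M))
    (bimod.fields (\<lambda>r x. \<lambda>i\<in>{..<N}. lact M r (x i)) (\<lambda>x s. \<lambda>i\<in>{..<N}. ract M (x i) s))"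

lemma bimodule_power_bimod:
  assumes "bimodule R S M"
  shows "bimodule R S (power_bimod M N)"
proof -
  interpret bimodule R S M by fact
  have g: "group (product_group {..<N} (\<lambda>_. M))" by simp
  have "comm_group (power_bimod M N)"
    unfolding power_bimod_def
    apply (rule comm_groupI)
    using group.l_inv_ex[OF g]
    by (auto simp: monoid.defs bimod.defs fun_eq_iff PiE_iff M.m_ac extensional_def)
  then show ?thesis
    by (intro bimodule.intro bimodule_axioms.intro R.ring_axioms S.ring_axioms)
       (auto simp: power_bimod_def monoid.defs bimod.defs lact_closed ract_closed
        lact_mult ract_mult lact_radd ract_sadd lact_rmult ract_smult lact_one ract_one lact_ract
        fun_eq_iff PiE_iff extensional_def)
qed

text \<open>The ring \<open>A\<close> as a bimodule, with both actions restricted along ring homomorphisms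
  \<open>f\<close> and \<open>g\<close> into \<open>A\<close>.\<close>

definition ring_bimod ::
  "('a, 'k) ring_scheme \<Rightarrow> ('r \<Rightarrow> 'a) \<Rightarrow> ('s \<Rightarrow> 'a) \<Rightarrow> ('r, 's, 'a) bimod"
  where "ring_bimod A f g = \<lparr>carrier = carrier A, monoid.mult = add A, one = \<zero>\<^bsub>A\<^esub>,
    lact = (\<lambda>r x. f r \<otimes>\<^bsub>A\<^esub> x), ract = (\<lambda>x s. x \<otimes>\<^bsub>A\<^esub> g s)\<rparr>"

lemma bimodule_ring_bimod:
  assumes "ring A" "ring R" "ring S" "f \<in> ring_hom R A" "g \<in> ring_hom S A"
  shows "bimodule R S (ring_bimod A f g)"
proof -
  interpret A: ring A by fact
  interpret R: ring R by fact
  interpret S: ring S by fact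
  note hom = ring_hom_closed[OF assms(4)] ring_hom_closed[OF assms(5)]
    ring_hom_add[OF assms(4)] ring_hom_add[OF assms(5)]
    ring_hom_mult[OF assms(4)] ring_hom_mult[OF assms(5)]
    ring_hom_one[OF assms(4)] ring_hom_one[OF assms(5)]
  have "comm_group (ring_bimod A f g)"
    unfolding ring_bimod_def
    by (rule comm_groupI) (use A.l_neg A.a_inv_closed in \<open>auto simp: A.add.m_ac\<close>)
  then show ?thesis
    by (intro bimodule.intro bimodule_axioms.intro assms)
       (simp_all add: ring_bimod_def hom A.l_distr A.r_distr A.m_assoc)
qed


section \<open>Tensor product over a not necessarily commutative ring\<close>

text \<open>\<open>M \<otimes>\<^sub>T N\<close> is the free abelian group on the set of pairs modulo the subgroup generated by
  the biadditivity and balancing relations.  Library free abelian groups consist of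
  \<open>int\<close>-valued finitely supported functions and are written additively.\<close>

definition tensor_free ::
  "('r, 't, 'm, 'c) bimod_scheme \<Rightarrow> ('t, 's, 'n, 'd) bimod_scheme \<Rightarrow> ('m \<times> 'n \<Rightarrow>\<^sub>0 int) monoid"
  where "tensor_free M N = free_Abelian_group (carrier M \<times> carrier N)"

definition tensor_rels ::
  "('t, 'k) ring_scheme \<Rightarrow> ('r, 't, 'm, 'c) bimod_scheme \<Rightarrow> ('t, 's, 'n, 'd) bimod_scheme \<Rightarrow>
   ('m \<times> 'n \<Rightarrow>\<^sub>0 int) set"
  where "tensor_rels T M N =
    {frag_of (x \<otimes>\<^bsub>M\<^esub> x', y) - frag_of (x, y) - frag_of (x', y) | x x' y.
       x \<in> carrier M \<and> x' \<in> carrier M \<and> y \<in> carrier N} \<union>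
    {frag_of (x, y \<otimes>\<^bsub>N\<^esub> y') - frag_of (x, y) - frag_of (x, y') | x y y'.
       x \<in> carrier M \<and> y \<in> carrier N \<and> y' \<in> carrier N} \<union>
    {frag_of (ract M x t, y) - frag_of (x, lact N t y) | x t y.
       x \<in> carrier M \<and> t \<in> carrier T \<and> y \<in> carrier N}"

definition tensor_kernel ::
  "('t, 'k) ring_scheme \<Rightarrow> ('r, 't, 'm, 'c) bimod_scheme \<Rightarrow> ('t, 's, 'n, 'd) bimod_scheme \<Rightarrow>
   ('m \<times> 'n \<Rightarrow>\<^sub>0 int) set"
  where "tensor_kernel T M N = generate (tensor_free M N) (tensor_rels T M N)"

text \<open>The map of quotients induced by \<open>(x, y) \<mapsto> p (x, y)\<close> on pairs.  If it preserves the
  relations, as the two actions below do, all cosets in the union coincide.\<close>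

definition tensor_map ::
  "('t, 'k) ring_scheme \<Rightarrow> ('r, 't, 'm, 'c) bimod_scheme \<Rightarrow> ('t, 's, 'n, 'd) bimod_scheme \<Rightarrow>
   ('m \<times> 'n \<Rightarrow> 'm \<times> 'n) \<Rightarrow> ('m \<times> 'n \<Rightarrow>\<^sub>0 int) set \<Rightarrow> ('m \<times> 'n \<Rightarrow>\<^sub>0 int) set"
  where "tensor_map T M N p U =
    (\<Union>c\<in>U. tensor_kernel T M N #>\<^bsub>tensor_free M N\<^esub> frag_extend (frag_of \<circ> p) c)"

definition tensor_bimod ::
  "('t, 'k) ring_scheme \<Rightarrow> ('r, 't, 'm, 'c) bimod_scheme \<Rightarrow> ('t, 's, 'n, 'd) bimod_scheme \<Rightarrow>
   ('r, 's, ('m \<times> 'n \<Rightarrow>\<^sub>0 int) set) bimod"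
  where "tensor_bimod T M N = monoid.extend (tensor_free M N Mod tensor_kernel T M N)
    (bimod.fields
      (\<lambda>r. tensor_map T M N (\<lambda>(x, y). (lact M r x, y)))
      (\<lambda>U s. tensor_map T M N (\<lambda>(x, y). (x, ract N y s)) U))"

lemma carrier_tensor_free:
  "c \<in> carrier (tensor_free M N) \<longleftrightarrow> Poly_Mapping.keys c \<subseteq> carrier M \<times> carrier N"
  by (simp add: tensor_free_def)

lemma mult_tensor_free [simp]: "c \<otimes>\<^bsub>tensor_free M N\<^esub> d = c + d"
  by (simp add: tensor_free_def)

lemma one_tensor_free [simp]: "\<one>\<^bsub>tensor_free M N\<^esub> = 0"
  by (simp add: tensor_free_def)

lemma inv_tensor_free [simp]: "c \<in> carrier (tensor_free M N) \<Longrightarrow> inv\<^bsub>tensor_free M N\<^esub> c = - c"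
  by (simp add: tensor_free_def)

context
  fixes R :: "('r, 'a) ring_scheme" and T :: "('t, 'k) ring_scheme" and S :: "('s, 'b) ring_scheme"
    and M :: "('r, 't, 'm, 'c) bimod_scheme" and N :: "('t, 's, 'n, 'd) bimod_scheme"
  assumes M: "bimodule R T M" and N: "bimodule T S N"
begin

interpretation M: bimodule R T M by (rule M)
interpretation N: bimodule T S N by (rule N)

private abbreviation "E \<equiv> tensor_free M N"
private abbreviation "J \<equiv> tensor_kernel T M N"

private lemma E_comm: "comm_group E" unfolding tensor_free_def by (rule abelian_free_Abelian_group)

interpretation E: comm_group E by (rule E_comm)

private lemmas carrE = carrier_tensor_free
private lemma diffE: "c \<in> carrier E \<Longrightarrow> d \<in> carrier E \<Longrightarrow> c - d \<in> carrier E"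
  using keys_diff[of c d] by (auto simp: carrE)
private lemma ofE: "x \<in> carrier M \<Longrightarrow> y \<in> carrier N \<Longrightarrow> frag_of (x, y) \<in> carrier E"
  by (simp add: carrE)

private lemma rels: "tensor_rels T M N \<subseteq> carrier E"
  unfolding tensor_rels_def
  by (auto intro!: diffE ofE simp: M.ract_closed N.lact_closed)

private lemma J_subgroup: "subgroup J E" unfolding tensor_kernel_def
  by (rule E.generate_is_subgroup[OF rels])

private lemma JE: "c \<in> J \<Longrightarrow> c \<in> carrier E" using subgroup.subset[OF J_subgroup] by blast

interpretation normal J E by (rule E.subgroup_imp_normal[OF J_subgroup])

private lemma J_rel: "c \<in> tensor_rels T M N \<Longrightarrow> c \<in> J"
  unfolding tensor_kernel_def by (rule generate.incl)

private lemma J_diff: "c \<in> J \<Longrightarrow> d \<in> J \<Longrightarrow> c - d \<in> J"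
  using subgroup.m_closed[OF J_subgroup, of c "-d"] subgroup.m_inv_closed[OF J_subgroup, of d] JE by simp

private lemma coset_eq: "c \<in> carrier E \<Longrightarrow> d \<in> carrier E \<Longrightarrow> J #>\<^bsub>E\<^esub> c = J #>\<^bsub>E\<^esub> d \<longleftrightarrow> c - d \<in> J"
proof 
  assume c: "c \<in> carrier E" "d \<in> carrier E"
  { assume "J #>\<^bsub>E\<^esub> c = J #>\<^bsub>E\<^esub> d"
    then have "c \<in> J #>\<^bsub>E\<^esub> d" using E.rcos_self[OF c(1) J_subgroup] by simp
    then show "c - d \<in> J" by (auto simp: r_coset_def) }
  { assume "c - d \<in> J"
    then have "c \<in> J #>\<^bsub>E\<^esub> d" by (force simp: r_coset_def)
    then show "J #>\<^bsub>E\<^esub> c = J #>\<^bsub>E\<^esub> d" using E.repr_independence[OF _ c(2) J_subgroup] by simp }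
qed

private lemma ext_carr:
  assumes "p \<in> carrier M \<times> carrier N \<rightarrow> carrier M \<times> carrier N" "c \<in> carrier E"
  shows "frag_extend (frag_of \<circ> p) c \<in> carrier E"
  using assms keys_frag_extend[of "frag_of \<circ> p" c] unfolding carrE o_def keys_frag_of by blast

private lemma ext_J:
  assumes "p \<in> carrier M \<times> carrier N \<rightarrow> carrier M \<times> carrier N"
    and "\<And>c. c \<in> tensor_rels T M N \<Longrightarrow> frag_extend (frag_of \<circ> p) c \<in> J"
    and "c \<in> J"
  shows "frag_extend (frag_of \<circ> p) c \<in> J"
  using assms(3) unfolding tensor_kernel_def
proof (induction rule: generate.induct)
  case one then show ?case using generate.one[of E] by simp
next
  case (incl h) then show ?case using assms(2)[OF incl] by (simp only: tensor_kernel_def)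
next
  case (inv h)
  then have "h \<in> carrier E" using rels by blast
  then show ?case using J_diff[of 0, OF _ assms(2)[OF inv]] subgroup.one_closed[OF J_subgroup]
    by (simp add: frag_extend_minus tensor_kernel_def o_def)
next
  case (eng h1 h2)
  then show ?case using generate.eng[OF eng(3) eng(4)] by (simp add: frag_extend_add)
qed

private lemma tensor_map_coset:
  assumes p: "p \<in> carrier M \<times> carrier N \<rightarrow> carrier M \<times> carrier N"
    and r: "\<And>c. c \<in> tensor_rels T M N \<Longrightarrow> frag_extend (frag_of \<circ> p) c \<in> J"
    and c: "c \<in> carrier E"
  shows "tensor_map T M N p (J #>\<^bsub>E\<^esub> c) = J #>\<^bsub>E\<^esub> frag_extend (frag_of \<circ> p) c"
proof -
  have "J #>\<^bsub>E\<^esub> frag_extend (frag_of \<circ> p) d = J #>\<^bsub>E\<^esub> frag_extend (frag_of \<circ> p) c"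
    if "d \<in> J #>\<^bsub>E\<^esub> c" for d
  proof -
    from that obtain j where j: "j \<in> J" "d = j + c" by (auto simp: r_coset_def)
    then have "d \<in> carrier E" using JE c E.m_closed by fastforce
    then show ?thesis using j ext_J[OF p r j(1)]
      using ext_carr[OF p c] ext_carr[OF p \<open>d \<in> carrier E\<close>] by (subst coset_eq) (auto simp: frag_extend_add)
  qed
  then show ?thesis unfolding tensor_map_def using E.rcos_self[OF c J_subgroup] by blast
qed

private lemma J1: "x \<in> carrier M \<Longrightarrow> x' \<in> carrier M \<Longrightarrow> y \<in> carrier N \<Longrightarrow>
   frag_of (x \<otimes>\<^bsub>M\<^esub> x', y) - frag_of (x, y) - frag_of (x', y) \<in> J"
  by (rule J_rel) (unfold tensor_rels_def, blast)
private lemma J2: "x \<in> carrier M \<Longrightarrow> y \<in> carrier N \<Longrightarrow> y' \<in> carrier N \<Longrightarrow>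
   frag_of (x, y \<otimes>\<^bsub>N\<^esub> y') - frag_of (x, y) - frag_of (x, y') \<in> J"
  by (rule J_rel) (unfold tensor_rels_def, blast)

private definition "pl r = (\<lambda>(x, y). (lact M r x, y))"
private definition "pr s = (\<lambda>(x, y). (x, ract N y s))"

private lemma pl: "r \<in> carrier R \<Longrightarrow> pl r \<in> carrier M \<times> carrier N \<rightarrow> carrier M \<times> carrier N"
  by (auto simp: pl_def M.lact_closed)
private lemma pr: "s \<in> carrier S \<Longrightarrow> pr s \<in> carrier M \<times> carrier N \<rightarrow> carrier M \<times> carrier N"
  by (auto simp: pr_def N.ract_closed)

private lemma pl_rel: "r \<in> carrier R \<Longrightarrow> c \<in> tensor_rels T M N \<Longrightarrow> frag_extend (frag_of \<circ> pl r) c \<in> J"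
  apply (rule J_rel)
  unfolding tensor_rels_def
  by (auto simp: pl_def frag_extend_diff M.lact_mult M.lact_closed N.lact_closed 
     M.lact_ract[symmetric]) (metis M.lact_closed M.lact_ract)+

private lemma pr_rel: "r \<in> carrier S \<Longrightarrow> c \<in> tensor_rels T M N \<Longrightarrow> frag_extend (frag_of \<circ> pr r) c \<in> J"
  apply (rule J_rel)
  unfolding tensor_rels_def
  by (auto simp: pr_def frag_extend_diff N.ract_mult N.ract_closed 
     N.lact_ract) (metis N.ract_closed N.lact_ract)+

private lemma lin_eq:
  assumes "c \<in> carrier E" "\<And>x y. x \<in> carrier M \<Longrightarrow> y \<in> carrier N \<Longrightarrow>
     frag_extend f (frag_of (x,y)) - frag_extend g (frag_of (x,y)) - frag_extend h (frag_of (x,y)) \<in> J"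
  shows "frag_extend f c - frag_extend g c - frag_extend h c \<in> J"
proof -
  have "Poly_Mapping.keys c \<subseteq> carrier M \<times> carrier N" using assms by (simp add: carrE)
  then show ?thesis
    apply (rule free_Abelian_group_induct)
    subgoal using subgroup.one_closed[OF J_subgroup] by simp
    subgoal premises p for x y using J_diff[OF p(3) p(4)] 
      by (simp add: frag_extend_diff algebra_simps)
    subgoal for a using assms(2)[of "fst a" "snd a"] by auto
    done
qed

lemma bimodule_tensor_bimod: "bimodule R S (tensor_bimod T M N)"
proof -
  have cg: "comm_group (E Mod J)" 
    by (rule group.group_comm_groupI[OF factorgroup_is_group])
       (auto simp: carrier_FactGroup rcos_sum add.commute)
  have car: "carrier (tensor_bimod T M N) = (\<lambda>c. J #>\<^bsub>E\<^esub> c) ` carrier E"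
    by (simp add: tensor_bimod_def monoid.defs carrier_FactGroup)
  have mul: "x \<otimes>\<^bsub>tensor_bimod T M N\<^esub> y = x <#>\<^bsub>E\<^esub> y" for x y
    by (simp add: tensor_bimod_def monoid.defs)
  have one: "\<one>\<^bsub>tensor_bimod T M N\<^esub> = J" 
    by (simp add: tensor_bimod_def monoid.defs)
  have la: "lact (tensor_bimod T M N) r (J #>\<^bsub>E\<^esub> c) = J #>\<^bsub>E\<^esub> frag_extend (frag_of \<circ> pl r) c"
    if "r \<in> carrier R" "c \<in> carrier E" for r c
    using tensor_map_coset[OF pl pl_rel] that
    by (simp add: tensor_bimod_def monoid.defs bimod.defs pl_def)
  have ra: "ract (tensor_bimod T M N) (J #>\<^bsub>E\<^esub> c) r = J #>\<^bsub>E\<^esub> frag_extend (frag_of \<circ> pr r) c"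
    if "r \<in> carrier S" "c \<in> carrier E" for r c
    using tensor_map_coset[OF pr pr_rel] that
    by (simp add: tensor_bimod_def monoid.defs bimod.defs pr_def)
  have ms: "(J #>\<^bsub>E\<^esub> c) <#>\<^bsub>E\<^esub> (J #>\<^bsub>E\<^esub> d) = J #>\<^bsub>E\<^esub> (c + d)" if "c \<in> carrier E" "d \<in> carrier E" for c d
    using rcos_sum[OF that] by simp
  have cl: "c + d \<in> carrier E" if "c \<in> carrier E" "d \<in> carrier E" for c d
    using E.m_closed[OF that] by simp
  interpret Q: comm_group "E Mod J" by (rule cg)
  have 1: "comm_group (tensor_bimod T M N)"
    apply (rule comm_groupI)
    using Q.m_closed Q.one_closed Q.m_assoc Q.m_comm Q.l_one Q.l_inv_ex
    by (auto simp: tensor_bimod_def monoid.defs)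
  have comp: "frag_extend (frag_of \<circ> p) (frag_extend (frag_of \<circ> q) c) = frag_extend (frag_of \<circ> (p \<circ> q)) c"
    for p q :: "'m \<times> 'n \<Rightarrow> 'm \<times> 'n" and c
    by (simp add: frag_extend_compose comp_assoc)
  have cong: "frag_extend (frag_of \<circ> p) c = frag_extend (frag_of \<circ> q) c"
    if "c \<in> carrier E" "\<And>x y. x \<in> carrier M \<Longrightarrow> y \<in> carrier N \<Longrightarrow> p (x,y) = q (x,y)"
    for p q :: "'m \<times> 'n \<Rightarrow> 'm \<times> 'n" and c
    apply (rule frag_extend_eq) using that by (auto simp: carrE)
  have idc: "frag_extend (frag_of \<circ> p) c = c"
    if "c \<in> carrier E" "\<And>x y. x \<in> carrier M \<Longrightarrow> y \<in> carrier N \<Longrightarrow> p (x,y) = (x,y)"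
    for p :: "'m \<times> 'n \<Rightarrow> 'm \<times> 'n" and c
    using cong[of c p id] that frag_expansion[of c] by simp
  have el: "frag_extend (frag_of \<circ> pl r) c \<in> carrier E" if "r \<in> carrier R" "c \<in> carrier E" for r c
    using ext_carr[OF pl] that by blast
  have er: "frag_extend (frag_of \<circ> pr r) c \<in> carrier E" if "r \<in> carrier S" "c \<in> carrier E" for r c
    using ext_carr[OF pr] that by blast
  show ?thesis
    apply (intro bimodule.intro bimodule_axioms.intro 1 M.R.ring_axioms N.S.ring_axioms)
               apply (auto simp: car mul la ra ms cl el er frag_extend_add comp del: equalityI)
      subgoal for r r' c
        apply (rule coset_eq[THEN iffD2])
        subgoal by (simp add: el)
        subgoal by (simp add: el cl)
        subgoal
          apply (subst diff_diff_eq[symmetric])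
          apply (rule lin_eq[of c "frag_of \<circ> pl (r \<oplus>\<^bsub>R\<^esub> r')" "frag_of \<circ> pl r" "frag_of \<circ> pl r'"])
           apply assumption
          using J1[OF M.lact_closed M.lact_closed] by (simp add: pl_def M.lact_radd M.lact_closed)
        done
      subgoal by (intro arg_cong[of _ _ "\<lambda>c. J #>\<^bsub>E\<^esub> c"] cong) (auto simp: pl_def M.lact_rmult)
      subgoal by (subst idc) (auto simp: pl_def M.lact_one)
      subgoal for r r' c
        apply (rule coset_eq[THEN iffD2])
        subgoal by (simp add: er)
        subgoal by (simp add: er cl)
        subgoal
          apply (subst diff_diff_eq[symmetric])
          apply (rule lin_eq[of c "frag_of \<circ> pr (r \<oplus>\<^bsub>S\<^esub> r')" "frag_of \<circ> pr r" "frag_of \<circ> pr r'"])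
           apply assumption
          using J2[OF _ N.ract_closed N.ract_closed] by (simp add: pr_def N.ract_sadd N.ract_closed)
        done
      subgoal by (intro arg_cong[of _ _ "\<lambda>c. J #>\<^bsub>E\<^esub> c"] cong) (auto simp: pr_def N.ract_smult)
      subgoal by (subst idc) (auto simp: pr_def N.ract_one)
      subgoal by (intro arg_cong[of _ _ "\<lambda>c. J #>\<^bsub>E\<^esub> c"] cong) (auto simp: pr_def pl_def)
    done
qed
end


section \<open>Towers of rings and depth three\<close>

locale ring_tower = A: ring A + B: ring B + C: ring C
  for A :: "('a, 'i) ring_scheme" and B :: "('b, 'j) ring_scheme" and C :: "('c, 'k) ring_scheme"
    and g :: "'b \<Rightarrow> 'a" and f :: "'c \<Rightarrow> 'b" +
  assumes g_hom: "g \<in> ring_hom B A"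
    and f_hom: "f \<in> ring_hom C B"

definition right_depth_three ::
  "('a, 'i) ring_scheme \<Rightarrow> ('b, 'j) ring_scheme \<Rightarrow> ('c, 'k) ring_scheme \<Rightarrow>
   ('b \<Rightarrow> 'a) \<Rightarrow> ('c \<Rightarrow> 'b) \<Rightarrow> bool"
  where "right_depth_three A B C g f \<longleftrightarrow> (\<exists>N>0. iso_to_direct_summand A C
    (tensor_bimod B (ring_bimod A id g) (ring_bimod A g (g \<circ> f)))
    (power_bimod (ring_bimod A id (g \<circ> f)) N))"

definition left_depth_three ::
  "('a, 'i) ring_scheme \<Rightarrow> ('b, 'j) ring_scheme \<Rightarrow> ('c, 'k) ring_scheme \<Rightarrow>
   ('b \<Rightarrow> 'a) \<Rightarrow> ('c \<Rightarrow> 'b) \<Rightarrow> bool"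
  where "left_depth_three A B C g f \<longleftrightarrow> (\<exists>N>0. iso_to_direct_summand C A
    (tensor_bimod B (ring_bimod A (g \<circ> f) g) (ring_bimod A g id))
    (power_bimod (ring_bimod A (g \<circ> f) id) N))"

definition depth_three ::
  "('a, 'i) ring_scheme \<Rightarrow> ('b, 'j) ring_scheme \<Rightarrow> ('c, 'k) ring_scheme \<Rightarrow>
   ('b \<Rightarrow> 'a) \<Rightarrow> ('c \<Rightarrow> 'b) \<Rightarrow> bool"
  where "depth_three A B C g f \<longleftrightarrow> right_depth_three A B C g f \<and> left_depth_three A B C g f"


section \<open>Group algebras and normal closure\<close>

text \<open>Elements are finitely supported functions vanishing off \<open>carrier G\<close>, so that for a
  subgroup \<open>H\<close> of \<open>G\<close> the group algebra of \<open>H\<close> is literally a subset of the group algebra of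
  \<open>G\<close>, with the identity map as inclusion.\<close>

definition group_algebra ::
  "('f, 'k) ring_scheme \<Rightarrow> ('g, 'l) monoid_scheme \<Rightarrow> ('g \<Rightarrow> 'f) ring"
  where "group_algebra F G = \<lparr>
    carrier = {a. (\<forall>x\<in>carrier G. a x \<in> carrier F) \<and> (\<forall>x. x \<notin> carrier G \<longrightarrow> a x = \<zero>\<^bsub>F\<^esub>)
                \<and> finite {x. a x \<noteq> \<zero>\<^bsub>F\<^esub>}},
    monoid.mult = (\<lambda>a b x. if x \<in> carrier G
      then \<Oplus>\<^bsub>F\<^esub>y\<in>{y \<in> carrier G. a y \<noteq> \<zero>\<^bsub>F\<^esub>}. a y \<otimes>\<^bsub>F\<^esub> b (inv\<^bsub>G\<^esub> y \<otimes>\<^bsub>G\<^esub> x) else \<zero>\<^bsub>F\<^esub>),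
    one = (\<lambda>x. if x = \<one>\<^bsub>G\<^esub> then \<one>\<^bsub>F\<^esub> else \<zero>\<^bsub>F\<^esub>),
    ring.zero = (\<lambda>x. \<zero>\<^bsub>F\<^esub>),
    ring.add = (\<lambda>a b x. a x \<oplus>\<^bsub>F\<^esub> b x)\<rparr>"

definition normal_closure :: "('g, 'l) monoid_scheme \<Rightarrow> 'g set \<Rightarrow> 'g set"
  where "normal_closure G K = \<Inter>{N. N \<lhd> G \<and> K \<subseteq> N}"

end

theory Submission
  imports Defs
begin

text \<open>Write \<open>G\<close> as the disjoint union of right cosets \<open>H u\<^sub>i\<close>, \<open>i < n\<close>, and let \<open>\<pi>\<^sub>i\<close> restrict the support
  of an element of \<open>A\<close> to \<open>H u\<^sub>i\<close>.  The \<open>\<pi>\<^sub>i\<close> are left \<open>B\<close>-linear; since \<open>u\<^sub>i K u\<^sub>i\<^sup>-\<^sup>1 \<subseteq> K\<^sup>G \<subseteq> H\<close>, every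
  \<open>H u\<^sub>i\<close> is stable under right multiplication by \<open>K\<close>, so they are also right \<open>C\<close>-linear.
  Hence \<open>x \<otimes> y \<mapsto> (x \<pi>\<^sub>i y)\<^sub>i\<close> is an isomorphism of \<open>A\<close>-\<open>C\<close>-bimodules from \<open>A \<otimes>\<^sub>B A\<close> onto the whole of
  \<open>A\<^sup>n\<close>, with inverse \<open>a \<mapsto> \<Sum>\<^sub>i a\<^sub>i u\<^sub>i\<^sup>-\<^sup>1 \<otimes> u\<^sub>i\<close>.  Left depth three is the mirror image, with the left
  cosets \<open>u\<^sub>i\<^sup>-\<^sup>1 H\<close>.\<close>

section \<open>Isomorphisms out of a tensor product\<close>

lemma (in bimodule) group_hom_lact: "r \<in> carrier R \<Longrightarrow> group_hom M M (lact M r)"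
  by unfold_locales (auto simp: hom_def lact_closed lact_mult)

lemma (in bimodule) group_hom_ract: "s \<in> carrier S \<Longrightarrow> group_hom M M (\<lambda>x. ract M x s)"
  by unfold_locales (auto simp: hom_def ract_closed ract_mult)

lemma iso_to_direct_summandI:
  assumes "bimodule R S N" and "h \<in> bimod_iso R S M N"
  shows "iso_to_direct_summand R S M N"
proof -
  interpret N: bimodule R S N by fact
  have "subbimodule R S (carrier N) N"
    by (auto simp: subbimodule_def N.lact_closed N.ract_closed N.M.subgroup_self)
  moreover have "subbimodule R S {\<one>\<^bsub>N\<^esub>} N"
    using group_hom.hom_one[OF N.group_hom_lact] group_hom.hom_one[OF N.group_hom_ract]
    by (auto simp: subbimodule_def N.M.triv_subgroup)
  moreover have "carrier N <#>\<^bsub>N\<^esub> {\<one>\<^bsub>N\<^esub>} = carrier N"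
    by (auto simp: set_mult_def)
  ultimately have "direct_summand R S (carrier N) N"
    by (auto simp: direct_summand_def)
  then show ?thesis
    using assms(2) by (auto simp: iso_to_direct_summand_def)
qed

section \<open>Computing in a tensor product through representatives in the free abelian
  group\<close>

locale tensor_factors = M: bimodule R T M + N: bimodule T S N
  for R :: "('r, 'a) ring_scheme" and T :: "('t, 'k) ring_scheme" and S :: "('s, 'b) ring_scheme"
    and M :: "('r, 't, 'm, 'c) bimod_scheme" and N :: "('t, 's, 'n, 'd) bimod_scheme"
begin

abbreviation "E \<equiv> tensor_free M N"
text \<open>\<open>c - d \<in> J\<close> is the working form of equality of \<open>c\<close> and
  \<open>d\<close> in the tensor product, so that cosets are handled only when the final isomorphism
  is built.\<close>

abbreviation "J \<equiv> tensor_kernel T M N"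

sublocale E: comm_group E
  unfolding tensor_free_def by (rule abelian_free_Abelian_group)

lemma frag_of_E: "x \<in> carrier M \<Longrightarrow> y \<in> carrier N \<Longrightarrow> frag_of (x, y) \<in> carrier E"
  by (simp add: carrier_tensor_free)

lemma diff_E: "c \<in> carrier E \<Longrightarrow> d \<in> carrier E \<Longrightarrow> c - d \<in> carrier E"
  using keys_diff[of c d] by (auto simp: carrier_tensor_free)

lemma sum_E: "(\<And>i. i < (n::nat) \<Longrightarrow> c i \<in> carrier E) \<Longrightarrow> (\<Sum>i<n. c i) \<in> carrier E"
  by (induction n) (use E.one_closed E.m_closed in auto)

lemma tensor_rels_subset: "tensor_rels T M N \<subseteq> carrier E"
  unfolding tensor_rels_def
  by (auto intro!: diff_E frag_of_E simp: M.ract_closed N.lact_closed)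

lemma subgroup_J: "subgroup J E"
  unfolding tensor_kernel_def by (rule E.generate_is_subgroup[OF tensor_rels_subset])

lemma J_subset: "c \<in> J \<Longrightarrow> c \<in> carrier E"
  using subgroup.subset[OF subgroup_J] by blast

lemma J_zero: "0 \<in> J"
  using subgroup.one_closed[OF subgroup_J] by simp

lemma J_add: "c \<in> J \<Longrightarrow> d \<in> J \<Longrightarrow> c + d \<in> J"
  using subgroup.m_closed[OF subgroup_J] by simp

lemma J_uminus: "c \<in> J \<Longrightarrow> - c \<in> J"
  using subgroup.m_inv_closed[OF subgroup_J] J_subset by fastforce

lemma J_diff: "c \<in> J \<Longrightarrow> d \<in> J \<Longrightarrow> c - d \<in> J"
  using J_add[OF _ J_uminus] by fastforce

lemma J_sum: "(\<And>i. i < (n::nat) \<Longrightarrow> c i \<in> J) \<Longrightarrow> (\<Sum>i<n. c i) \<in> J"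
  by (induction n) (use J_zero J_add in auto)

lemma J_trans: "c - d \<in> J \<Longrightarrow> d - e \<in> J \<Longrightarrow> c - e \<in> J"
  using J_add[of "c - d" "d - e"] by simp

text \<open>The usual computation with a sum of tensors: replace each summand by an equal one, then
  collapse the new sum to \<open>e\<close>.\<close>

lemma J_sum_trans:
  assumes "\<And>i. i < (n::nat) \<Longrightarrow> c i - d i \<in> J" and "(\<Sum>i<n. d i) - e \<in> J"
  shows "(\<Sum>i<n. c i) - e \<in> J"
  using J_sum[of n "\<lambda>i. c i - d i"] J_trans[OF _ assms(2)] assms(1) by (simp add: sum_subtractf)

lemma J_add_left: "x \<in> carrier M \<Longrightarrow> x' \<in> carrier M \<Longrightarrow> y \<in> carrier N \<Longrightarrow>
    frag_of (x \<otimes>\<^bsub>M\<^esub> x', y) - frag_of (x, y) - frag_of (x', y) \<in> J"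
  unfolding tensor_kernel_def by (rule generate.incl) (unfold tensor_rels_def, blast)

lemma J_add_right: "x \<in> carrier M \<Longrightarrow> y \<in> carrier N \<Longrightarrow> y' \<in> carrier N \<Longrightarrow>
    frag_of (x, y \<otimes>\<^bsub>N\<^esub> y') - frag_of (x, y) - frag_of (x, y') \<in> J"
  unfolding tensor_kernel_def by (rule generate.incl) (unfold tensor_rels_def, blast)

lemma J_balanced: "x \<in> carrier M \<Longrightarrow> t \<in> carrier T \<Longrightarrow> y \<in> carrier N \<Longrightarrow>
    frag_of (ract M x t, y) - frag_of (x, lact N t y) \<in> J"
  unfolding tensor_kernel_def by (rule generate.incl) (unfold tensor_rels_def, blast)

text \<open>Biadditivity extended to \<open>n\<close> terms by induction. The product in
  \<open>M\<close> is its module addition, since bimodules are written multiplicatively.\<close>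

lemma J_finprod_left:
  assumes "\<And>i. i < n \<Longrightarrow> x i \<in> carrier M" and y: "y \<in> carrier N"
  shows "(\<Sum>i<n. frag_of (x i, y)) - frag_of (finprod M x {..<(n::nat)}, y) \<in> J"
  using assms(1)
proof (induction n)
  case 0
  then show ?case
    \<comment> \<open>With both arguments neutral, the additivity relation reduces to minus the pair
      of the neutral element and \<open>y\<close>, which is the claim for the empty sum.\<close>
    using J_add_left[of "\<one>\<^bsub>M\<^esub>" "\<one>\<^bsub>M\<^esub>" y] y by simp
next
  case (Suc n)
  have "finprod M x {..<n} \<in> carrier M"
    using Suc.prems by (intro M.M.finprod_closed) auto
  then have "frag_of (x n, y) + frag_of (finprod M x {..<n}, y)
      - frag_of (finprod M x {..<Suc n}, y) \<in> J"
    using J_uminus[OF J_add_left[of "x n" "finprod M x {..<n}" y]] Suc.prems y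
    by (subst lessThan_Suc, subst M.M.finprod_insert) (auto simp: algebra_simps)
  moreover have "(\<Sum>i<n. frag_of (x i, y)) - frag_of (finprod M x {..<n}, y) \<in> J"
    using Suc by simp
  ultimately show ?case
    using J_add by (fastforce simp: algebra_simps)
qed

lemma J_finprod_right:
  assumes "\<And>i. i < n \<Longrightarrow> y i \<in> carrier N" and x: "x \<in> carrier M"
  shows "(\<Sum>i<n. frag_of (x, y i)) - frag_of (x, finprod N y {..<(n::nat)}) \<in> J"
  using assms(1)
proof (induction n)
  case 0
  then show ?case
    using J_add_right[of x "\<one>\<^bsub>N\<^esub>" "\<one>\<^bsub>N\<^esub>"] x by simp
next
  case (Suc n)
  have "finprod N y {..<n} \<in> carrier N"
    using Suc.prems by (intro N.M.finprod_closed) auto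
  then have "frag_of (x, y n) + frag_of (x, finprod N y {..<n})
      - frag_of (x, finprod N y {..<Suc n}) \<in> J"
    using J_uminus[OF J_add_right[of x "y n" "finprod N y {..<n}"]] Suc.prems x
    by (subst lessThan_Suc, subst N.M.finprod_insert) (auto simp: algebra_simps)
  moreover have "(\<Sum>i<n. frag_of (x, y i)) - frag_of (x, finprod N y {..<n}) \<in> J"
    using Suc by simp
  ultimately show ?case
    using J_add by (fastforce simp: algebra_simps)
qed

text \<open>The pairs generate the free abelian group, and closure under differences covers sums and
  negatives at once.\<close>

lemma E_induct [consumes 1, case_names zero diff pair]:
  assumes "c \<in> carrier E" and "P 0"
    and "\<And>c d. c \<in> carrier E \<Longrightarrow> d \<in> carrier E \<Longrightarrow> P c \<Longrightarrow> P d \<Longrightarrow> P (c - d)"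
    and "\<And>x y. x \<in> carrier M \<Longrightarrow> y \<in> carrier N \<Longrightarrow> P (frag_of (x, y))"
  shows "P c"
  using assms(1)[unfolded carrier_tensor_free]
  by (rule free_Abelian_group_induct) (use assms(2-) in \<open>auto simp: carrier_tensor_free\<close>)

text \<open>A first isomorphism theorem with an explicit inverse. Balanced biadditivity gives that
  \<open>h\<close> kills \<open>J\<close>. The section \<open>\<sigma>\<close> is additive modulo
  \<open>J\<close> and undoes \<open>h\<close> on pairs modulo \<open>J\<close>, hence on all of
  \<open>E\<close>; this forces the kernel of \<open>h\<close> to be exactly \<open>J\<close>, while
  \<open>h_\<sigma>\<close> gives surjectivity.\<close>

lemma tensor_bimod_iso:
  assumes Q: "bimodule R S Q" and h: "h \<in> hom E Q"
    and add_left: "\<And>x x' y. x \<in> carrier M \<Longrightarrow> x' \<in> carrier M \<Longrightarrow> y \<in> carrier N \<Longrightarrow>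
      h (frag_of (x \<otimes>\<^bsub>M\<^esub> x', y)) = h (frag_of (x, y)) \<otimes>\<^bsub>Q\<^esub> h (frag_of (x', y))"
    and add_right: "\<And>x y y'. x \<in> carrier M \<Longrightarrow> y \<in> carrier N \<Longrightarrow> y' \<in> carrier N \<Longrightarrow>
      h (frag_of (x, y \<otimes>\<^bsub>N\<^esub> y')) = h (frag_of (x, y)) \<otimes>\<^bsub>Q\<^esub> h (frag_of (x, y'))"
    and balanced: "\<And>x t y. x \<in> carrier M \<Longrightarrow> t \<in> carrier T \<Longrightarrow> y \<in> carrier N \<Longrightarrow>
      h (frag_of (ract M x t, y)) = h (frag_of (x, lact N t y))"
    and left: "\<And>r x y. r \<in> carrier R \<Longrightarrow> x \<in> carrier M \<Longrightarrow> y \<in> carrier N \<Longrightarrow>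
      h (frag_of (lact M r x, y)) = lact Q r (h (frag_of (x, y)))"
    and right: "\<And>x y s. x \<in> carrier M \<Longrightarrow> y \<in> carrier N \<Longrightarrow> s \<in> carrier S \<Longrightarrow>
      h (frag_of (x, ract N y s)) = ract Q (h (frag_of (x, y))) s"
    and \<sigma>: "\<And>a. a \<in> carrier Q \<Longrightarrow> \<sigma> a \<in> carrier E"
    and \<sigma>_add: "\<And>a b. a \<in> carrier Q \<Longrightarrow> b \<in> carrier Q \<Longrightarrow> \<sigma> (a \<otimes>\<^bsub>Q\<^esub> b) - \<sigma> a - \<sigma> b \<in> J"
    and h_\<sigma>: "\<And>a. a \<in> carrier Q \<Longrightarrow> h (\<sigma> a) = a"
    and \<sigma>_h: "\<And>x y. x \<in> carrier M \<Longrightarrow> y \<in> carrier N \<Longrightarrow> \<sigma> (h (frag_of (x, y))) - frag_of (x, y) \<in> J"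
  shows "(\<lambda>U. the_elem (h ` U)) \<in> bimod_iso R S (tensor_bimod T M N) Q"
proof -
  interpret Q: bimodule R S Q by fact
  interpret h: group_hom E Q h
    by unfold_locales (rule h)
  have hc: "h c \<in> carrier Q" if "c \<in> carrier E" for c
    using that by simp
  have h_diff: "h (c - d) = h c \<otimes>\<^bsub>Q\<^esub> inv\<^bsub>Q\<^esub> h d" if "c \<in> carrier E" "d \<in> carrier E" for c d
    using h.hom_mult[of c "inv\<^bsub>E\<^esub> d"] h.hom_inv[OF that(2)] that E.inv_closed[OF that(2)] by simp
  \<comment> \<open>This is the value of \<open>h\<close> on an additivity relation, once
    \<open>h\<close> is expanded over the differences.\<close>
  have "a \<otimes>\<^bsub>Q\<^esub> b \<otimes>\<^bsub>Q\<^esub> inv\<^bsub>Q\<^esub> a \<otimes>\<^bsub>Q\<^esub> inv\<^bsub>Q\<^esub> b = \<one>\<^bsub>Q\<^esub>" if "a \<in> carrier Q" "b \<in> carrier Q" for a b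
    using that by (simp add: Q.M.m_comm[of a b] Q.M.m_assoc)
  then have "tensor_rels T M N \<subseteq> kernel E Q h"
    unfolding tensor_rels_def kernel_def
    by (auto simp: h_diff diff_E frag_of_E M.ract_closed N.lact_closed add_left add_right balanced hc)
  then have J_kernel: "J \<subseteq> kernel E Q h"
    unfolding tensor_kernel_def by (rule E.generate_subgroup_incl[OF _ h.subgroup_kernel])
  \<comment> \<open>Additivity modulo \<open>J\<close> at two neutral elements leaves minus the
    image of the neutral element.\<close>
  have \<sigma>_one: "\<sigma> \<one>\<^bsub>Q\<^esub> \<in> J"
    using J_uminus[OF \<sigma>_add[of "\<one>\<^bsub>Q\<^esub>" "\<one>\<^bsub>Q\<^esub>"]] by simp
  have \<sigma>_h_E: "\<sigma> (h c) - c \<in> J" if "c \<in> carrier E" for c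
    using that
  proof (induction rule: E_induct)
    case zero
    show ?case using \<sigma>_one h.hom_one by simp
  next
    case (diff c d)
    \<comment> \<open>Additivity of \<open>\<sigma>\<close> is applied to \<open>h (c - d)\<close>
      and \<open>h d\<close>, whose product is \<open>h c\<close>. Subtracting this from the
      difference of the two induction hypotheses gives the claim for \<open>c - d\<close>.\<close>
    have "\<sigma> (h c) - \<sigma> (h (c - d)) - \<sigma> (h d) \<in> J"
      using \<sigma>_add[of "h (c - d)" "h d"] diff(1,2) diff_E by (simp add: h_diff Q.M.m_assoc)
    then show ?case
      using J_diff[OF J_diff[OF diff(3) diff(4)]] by (fastforce simp: algebra_simps)
  next
    case (pair x y)
    then show ?case by (rule \<sigma>_h)
  qed
  have ker: "kernel E Q h = J"
  proof
    show "kernel E Q h \<subseteq> J"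
    proof
      fix c assume "c \<in> kernel E Q h"
      then have "c \<in> carrier E" "h c = \<one>\<^bsub>Q\<^esub>" by (auto simp: kernel_def)
      then show "c \<in> J"
        \<comment> \<open>On the kernel \<open>\<sigma> (h c)\<close> is \<open>\<sigma>\<close> of
          the neutral element, so the two elements of \<open>J\<close> differ by exactly
          \<open>c\<close>.\<close>
        using J_diff[OF \<sigma>_one \<sigma>_h_E[of c]] by simp
    qed
  qed (rule J_kernel)
  have "h ` carrier E = carrier Q"
    using h_\<sigma> \<sigma> by (auto simp: image_iff) metis
  then have iso: "(\<lambda>U. the_elem (h ` U)) \<in> iso (E Mod J) Q"
    using h.FactGroup_iso_set ker by simp
  have car: "carrier (tensor_bimod T M N) = carrier (E Mod J)"
    and mult: "monoid.mult (tensor_bimod T M N) = monoid.mult (E Mod J)"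
    by (simp_all add: tensor_bimod_def monoid.defs)
  \<comment> \<open>\<open>h\<close> is constant on each coset of \<open>J\<close>, so the induced
    map may be evaluated at any representative.\<close>
  have on_coset: "h c = the_elem (h ` U)" "c \<in> carrier E" "the_elem (h ` U) \<in> carrier Q"
    if "U \<in> carrier (E Mod J)" "c \<in> U" for U c
  proof -
    obtain d where d: "d \<in> carrier E" "U = J #>\<^bsub>E\<^esub> d"
      using \<open>U \<in> carrier (E Mod J)\<close> by (auto simp: carrier_FactGroup)
    have "h e = h d \<and> e \<in> carrier E" if e: "e \<in> U" for e
    proof -
      obtain j where j: "j \<in> J" "e = j + d"
        using e d(2) unfolding r_coset_def by auto
      then have "h j = \<one>\<^bsub>Q\<^esub>" "j \<in> carrier E"
        using J_kernel by (auto simp: kernel_def)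
      then show ?thesis
        using h.hom_mult[of j d] E.m_closed[of j d] d(1) j(2) by simp
    qed
    moreover from this have "h ` U = {h d}"
      using that(2) by auto
    ultimately show "h c = the_elem (h ` U)" "c \<in> carrier E" "the_elem (h ` U) \<in> carrier Q"
      using that(2) d(1) hc by simp_all
  qed
  have nonempty: "U \<noteq> {}" if "U \<in> carrier (E Mod J)" for U
    using that E.rcos_self[OF _ subgroup_J] by (auto simp: carrier_FactGroup)
  \<comment> \<open>Both actions are instances: \<open>p\<close> is the action of a scalar on pairs,
    \<open>\<phi>\<close> its action on \<open>Q\<close>. Since \<open>tensor_map\<close> is a union
    of cosets over all representatives, \<open>h\<close> has to be shown constant on that union and
    the union nonempty.\<close>
  have map: "the_elem (h ` tensor_map T M N p U) = \<phi> (the_elem (h ` U))"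
    if p: "\<And>x y. x \<in> carrier M \<Longrightarrow> y \<in> carrier N \<Longrightarrow> frag_of (p (x, y)) \<in> carrier E"
      "\<And>x y. x \<in> carrier M \<Longrightarrow> y \<in> carrier N \<Longrightarrow> h (frag_of (p (x, y))) = \<phi> (h (frag_of (x, y)))"
      and \<phi>: "group_hom Q Q \<phi>" and U: "U \<in> carrier (E Mod J)" for p \<phi> U
  proof -
    interpret \<phi>: group_hom Q Q \<phi> by fact
    have ext: "frag_extend (frag_of \<circ> p) c \<in> carrier E \<and>
        h (frag_extend (frag_of \<circ> p) c) = \<phi> (h c)" if "c \<in> carrier E" for c
      using that
    proof (induction rule: E_induct)
      case zero
      show ?case using h.hom_one E.one_closed by simp
    next
      case (diff c d)
      then show ?case by (simp add: frag_extend_diff h_diff diff_E)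
    next
      case (pair x y)
      then show ?case using p by simp
    qed
    have "e \<in> J #>\<^bsub>E\<^esub> frag_extend (frag_of \<circ> p) c \<Longrightarrow> c \<in> carrier E \<Longrightarrow> h e = \<phi> (h c)" for c e
      using on_coset(1)[of "J #>\<^bsub>E\<^esub> frag_extend (frag_of \<circ> p) c"] ext[of c]
        E.rcos_self[OF _ subgroup_J]
      by (auto simp: carrier_FactGroup)
    then have "h e = \<phi> (the_elem (h ` U))" if "e \<in> tensor_map T M N p U" for e
      using that on_coset[OF U] by (force simp: tensor_map_def)
    moreover have "tensor_map T M N p U \<noteq> {}"
      using nonempty[OF U] on_coset(2)[OF U] ext E.rcos_self[OF _ subgroup_J]
      by (fastforce simp: tensor_map_def)
    ultimately show ?thesis
      by (metis (no_types, lifting) the_elem_image_unique)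
  qed
  show ?thesis
    unfolding bimod_iso_def
  proof (intro CollectI conjI ballI)
    show "(\<lambda>U. the_elem (h ` U)) \<in> iso (tensor_bimod T M N) Q"
      using iso by (simp add: iso_def hom_def car mult)
    show "the_elem (h ` lact (tensor_bimod T M N) r U) = lact Q r (the_elem (h ` U))"
      if "r \<in> carrier R" "U \<in> carrier (tensor_bimod T M N)" for r U
      using map[of "\<lambda>(x, y). (lact M r x, y)" "lact Q r" U] Q.group_hom_lact that left
      by (simp add: tensor_bimod_def monoid.defs bimod.defs frag_of_E M.lact_closed)
    show "the_elem (h ` ract (tensor_bimod T M N) U s) = ract Q (the_elem (h ` U)) s"
      if "s \<in> carrier S" "U \<in> carrier (tensor_bimod T M N)" for s U
      using map[of "\<lambda>(x, y). (x, ract N y s)" "\<lambda>x. ract Q x s" U] Q.group_hom_ract that right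
      by (simp add: tensor_bimod_def monoid.defs bimod.defs frag_of_E N.ract_closed)
  qed
qed

text \<open>The preceding criterion for \<open>P\<close> to the power \<open>n\<close>, in
  components: \<open>\<phi> i\<close> is the \<open>i\<close>-th component of the isomorphism, and
  the tensor of \<open>p i a\<close> and \<open>q i a\<close> is the preimage of \<open>a\<close>
  placed in slot \<open>i\<close>. \<open>\<phi>_pq\<close> and \<open>pq_\<phi>\<close> say that
  the two directions are mutually inverse. The image is the whole power, a direct summand with
  trivial complement.\<close>

lemma iso_to_power_summand:
  assumes P: "bimodule R S P"
    and \<phi>: "\<And>i x y. i < n \<Longrightarrow> x \<in> carrier M \<Longrightarrow> y \<in> carrier N \<Longrightarrow> \<phi> i x y \<in> carrier P"
    and add_left: "\<And>i x x' y. i < n \<Longrightarrow> x \<in> carrier M \<Longrightarrow> x' \<in> carrier M \<Longrightarrow> y \<in> carrier N \<Longrightarrow>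
      \<phi> i (x \<otimes>\<^bsub>M\<^esub> x') y = \<phi> i x y \<otimes>\<^bsub>P\<^esub> \<phi> i x' y"
    and add_right: "\<And>i x y y'. i < n \<Longrightarrow> x \<in> carrier M \<Longrightarrow> y \<in> carrier N \<Longrightarrow> y' \<in> carrier N \<Longrightarrow>
      \<phi> i x (y \<otimes>\<^bsub>N\<^esub> y') = \<phi> i x y \<otimes>\<^bsub>P\<^esub> \<phi> i x y'"
    and balanced: "\<And>i x t y. i < n \<Longrightarrow> x \<in> carrier M \<Longrightarrow> t \<in> carrier T \<Longrightarrow> y \<in> carrier N \<Longrightarrow>
      \<phi> i (ract M x t) y = \<phi> i x (lact N t y)"
    and left: "\<And>i r x y. i < n \<Longrightarrow> r \<in> carrier R \<Longrightarrow> x \<in> carrier M \<Longrightarrow> y \<in> carrier N \<Longrightarrow>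
      \<phi> i (lact M r x) y = lact P r (\<phi> i x y)"
    and right: "\<And>i x y s. i < n \<Longrightarrow> x \<in> carrier M \<Longrightarrow> y \<in> carrier N \<Longrightarrow> s \<in> carrier S \<Longrightarrow>
      \<phi> i x (ract N y s) = ract P (\<phi> i x y) s"
    and p: "\<And>i a. i < n \<Longrightarrow> a \<in> carrier P \<Longrightarrow> p i a \<in> carrier M"
    and q: "\<And>i a. i < n \<Longrightarrow> a \<in> carrier P \<Longrightarrow> q i a \<in> carrier N"
    and pq_add: "\<And>i a b. i < n \<Longrightarrow> a \<in> carrier P \<Longrightarrow> b \<in> carrier P \<Longrightarrow>
      frag_of (p i (a \<otimes>\<^bsub>P\<^esub> b), q i (a \<otimes>\<^bsub>P\<^esub> b)) - frag_of (p i a, q i a) - frag_of (p i b, q i b) \<in> J"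
    and \<phi>_pq: "\<And>i j a. i < n \<Longrightarrow> j < n \<Longrightarrow> a \<in> carrier P \<Longrightarrow>
      \<phi> j (p i a) (q i a) = (if i = j then a else \<one>\<^bsub>P\<^esub>)"
    and pq_\<phi>: "\<And>x y. x \<in> carrier M \<Longrightarrow> y \<in> carrier N \<Longrightarrow>
      (\<Sum>i<n. frag_of (p i (\<phi> i x y), q i (\<phi> i x y))) - frag_of (x, y) \<in> J"
  shows "iso_to_direct_summand R S (tensor_bimod T M N) (power_bimod P n)"
proof -
  interpret P: bimodule R S P by fact
  let ?Q = "power_bimod P n"
  interpret Q: bimodule R S ?Q
    using P by (rule bimodule_power_bimod)
  have Qs: "carrier ?Q = {..<n} \<rightarrow>\<^sub>E carrier P"
    "a \<otimes>\<^bsub>?Q\<^esub> b = (\<lambda>i\<in>{..<n}. a i \<otimes>\<^bsub>P\<^esub> b i)" "\<one>\<^bsub>?Q\<^esub> = (\<lambda>i\<in>{..<n}. \<one>\<^bsub>P\<^esub>)"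
    "lact ?Q r a = (\<lambda>i\<in>{..<n}. lact P r (a i))" "ract ?Q a s = (\<lambda>i\<in>{..<n}. ract P (a i) s)"
    for a b r s
    by (simp_all add: power_bimod_def monoid.defs bimod.defs)
  have comp: "a i \<in> carrier P" if "a \<in> carrier ?Q" "i < n" for a i
    using PiE_mem[of a "{..<n}" "\<lambda>_. carrier P" i] that by (simp add: Qs)
  \<comment> \<open>The universal property of the free abelian group extends the tuple of the
    \<open>\<phi> i\<close> from pairs to \<open>E\<close>.\<close>
  obtain h where h: "h \<in> hom E ?Q"
    and h_frag: "\<And>z. z \<in> carrier M \<times> carrier N \<Longrightarrow>
      h (frag_of z) = (\<lambda>i\<in>{..<n}. \<phi> i (fst z) (snd z))"
  proof (rule Q.M.free_Abelian_group_universal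
      [of "\<lambda>z. \<lambda>i\<in>{..<n}. \<phi> i (fst z) (snd z)" "carrier M \<times> carrier N"])
    show "(\<lambda>z. \<lambda>i\<in>{..<n}. \<phi> i (fst z) (snd z)) ` (carrier M \<times> carrier N) \<subseteq> carrier ?Q"
      by (auto simp: Qs \<phi> split: if_splits)
  qed (use that in \<open>simp add: tensor_free_def\<close>)
  interpret h: group_hom E ?Q h
    by unfold_locales (rule h)
  define \<sigma> where "\<sigma> a = (\<Sum>i<n. frag_of (p i (a i), q i (a i)))" for a
  have frag_E: "frag_of (p i (a i), q i (a i)) \<in> carrier E" if "i < n" "a \<in> carrier ?Q" for i a
    using that by (intro frag_of_E p q comp)
  have \<sigma>: "\<sigma> a \<in> carrier E" if "a \<in> carrier ?Q" for a
    using frag_E that by (simp add: \<sigma>_def sum_E)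
  have h_\<sigma>: "h (\<sigma> a) = a" if a: "a \<in> carrier ?Q" for a
  proof -
    \<comment> \<open>Partial sums fill the slots one at a time: after \<open>m\<close> terms, slot
      \<open>j\<close> holds \<open>a j\<close> if \<open>j < m\<close> and is still neutral
      otherwise. The case \<open>m = n\<close> is the claim.\<close>
    have "h (\<Sum>i<m. frag_of (p i (a i), q i (a i))) j = (if j < m then a j else \<one>\<^bsub>P\<^esub>)"
      if "m \<le> n" "j < n" for m j
      using that(1)
    proof (induction m)
      case 0
      then show ?case using h.hom_one \<open>j < n\<close> by (simp add: Qs)
    next
      case (Suc m)
      have ai: "a m \<in> carrier P" "a j \<in> carrier P" using a Suc.prems \<open>j < n\<close> by (simp_all add: comp)
      have "(\<Sum>i<m. frag_of (p i (a i), q i (a i))) \<in> carrier E"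
        using frag_E[OF _ a] Suc.prems by (intro sum_E) simp
      then have "h (\<Sum>i<Suc m. frag_of (p i (a i), q i (a i))) j
          = h (\<Sum>i<m. frag_of (p i (a i), q i (a i))) j \<otimes>\<^bsub>P\<^esub> \<phi> j (p m (a m)) (q m (a m))"
        using h.hom_mult[of "\<Sum>i<m. frag_of (p i (a i), q i (a i))" "frag_of (p m (a m), q m (a m))"]
          frag_E[OF _ a, of m] Suc.prems \<open>j < n\<close> ai p q by (simp add: Qs h_frag)
      then show ?case
        using Suc \<phi>_pq[of m j "a m"] \<open>j < n\<close> ai by (auto simp: less_Suc_eq)
    qed
    moreover have "h (\<sigma> a) \<in> carrier ?Q" using \<sigma>[OF a] by simp
    ultimately show ?thesis
      using a by (intro PiE_ext[of _ "{..<n}" "\<lambda>_. carrier P"]) (auto simp: Qs \<sigma>_def)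
  qed
  have \<sigma>_add: "\<sigma> (a \<otimes>\<^bsub>?Q\<^esub> b) - \<sigma> a - \<sigma> b \<in> J" if "a \<in> carrier ?Q" "b \<in> carrier ?Q" for a b
  proof -
    show ?thesis
      unfolding \<sigma>_def sum_subtractf[symmetric]
      by (intro J_sum) (use comp that pq_add in \<open>simp add: Qs\<close>)
  qed
  have \<sigma>_h: "\<sigma> (h (frag_of (x, y))) - frag_of (x, y) \<in> J" if "x \<in> carrier M" "y \<in> carrier N" for x y
    using pq_\<phi>[OF that] that by (simp add: \<sigma>_def h_frag)
  have "(\<lambda>U. the_elem (h ` U)) \<in> bimod_iso R S (tensor_bimod T M N) ?Q"
    by (rule tensor_bimod_iso[OF Q.bimodule_axioms h, where \<sigma> = \<sigma>])
      ((auto simp: Qs(2,4,5) h_frag add_left add_right balanced left right M.ract_closed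
        M.lact_closed N.lact_closed N.ract_closed intro!: restrict_ext)[5],
       (rule \<sigma> \<sigma>_add h_\<sigma> \<sigma>_h, assumption+)+)
  then show ?thesis
    by (rule iso_to_direct_summandI[OF Q.bimodule_axioms])
qed

end

section \<open>Criteria for depth three\<close>

lemma ring_bimod_simps:
  "carrier (ring_bimod A f g) = carrier A" "monoid.mult (ring_bimod A f g) = add A"
  "\<one>\<^bsub>ring_bimod A f g\<^esub> = \<zero>\<^bsub>A\<^esub>" "lact (ring_bimod A f g) r x = f r \<otimes>\<^bsub>A\<^esub> x"
  "ract (ring_bimod A f g) x s = x \<otimes>\<^bsub>A\<^esub> g s"
  by (simp_all add: ring_bimod_def)

lemma finprod_ring_bimod: "finprod (ring_bimod A f g) x I = finsum A x I"
  by (simp add: finsum_def finprod_def ring_bimod_def)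

text \<open>Each \<open>\<pi> i y\<close> equals \<open>\<pi> i y \<otimes> v i\<close> times
  \<open>u i\<close>, with the first factor in the image of \<open>B\<close>. So in the tensor
  product, \<open>x \<otimes> y\<close> is the sum of the \<open>x \<otimes> \<pi> i y\<close>, that
  is, of the tensors of \<open>x \<pi> i y v i\<close> with \<open>u i\<close>. Hence
  \<open>x \<pi> i y\<close> are coordinates, and \<open>a\<close> in slot \<open>i\<close> comes
  from \<open>a v i\<close> tensored with \<open>u i\<close>.\<close>

lemma (in ring_tower) right_depth_threeI:
  assumes "(n :: nat) > 0"
    and \<pi>: "\<And>i x. i < n \<Longrightarrow> x \<in> carrier A \<Longrightarrow> \<pi> i x \<in> carrier A"
    and \<pi>_add: "\<And>i x y. i < n \<Longrightarrow> x \<in> carrier A \<Longrightarrow> y \<in> carrier A \<Longrightarrow>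
      \<pi> i (x \<oplus>\<^bsub>A\<^esub> y) = \<pi> i x \<oplus>\<^bsub>A\<^esub> \<pi> i y"
    and \<pi>_left: "\<And>i b x. i < n \<Longrightarrow> b \<in> carrier B \<Longrightarrow> x \<in> carrier A \<Longrightarrow>
      \<pi> i (g b \<otimes>\<^bsub>A\<^esub> x) = g b \<otimes>\<^bsub>A\<^esub> \<pi> i x"
    and \<pi>_right: "\<And>i c x. i < n \<Longrightarrow> c \<in> carrier C \<Longrightarrow> x \<in> carrier A \<Longrightarrow>
      \<pi> i (x \<otimes>\<^bsub>A\<^esub> g (f c)) = \<pi> i x \<otimes>\<^bsub>A\<^esub> g (f c)"
    and u: "\<And>i. i < n \<Longrightarrow> u i \<in> carrier A" and v: "\<And>i. i < n \<Longrightarrow> v i \<in> carrier A"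
    and vu: "\<And>i. i < n \<Longrightarrow> v i \<otimes>\<^bsub>A\<^esub> u i = \<one>\<^bsub>A\<^esub>"
    and \<pi>_u: "\<And>i j. i < n \<Longrightarrow> j < n \<Longrightarrow> \<pi> j (u i) = (if i = j then u i else \<zero>\<^bsub>A\<^esub>)"
    and \<pi>_v: "\<And>i x. i < n \<Longrightarrow> x \<in> carrier A \<Longrightarrow> \<pi> i x \<otimes>\<^bsub>A\<^esub> v i \<in> g ` carrier B"
    and \<pi>_sum: "\<And>x. x \<in> carrier A \<Longrightarrow> (\<Oplus>\<^bsub>A\<^esub>i\<in>{..<n}. \<pi> i x) = x"
  shows "right_depth_three A B C g f"
proof -
  let ?M = "ring_bimod A id g" and ?N = "ring_bimod A g (g \<circ> f)" and ?P = "ring_bimod A id (g \<circ> f)"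
  let ?J = "tensor_kernel B ?M ?N"
  have gf: "g \<circ> f \<in> ring_hom C A"
    using f_hom g_hom by (rule ring_hom_trans)
  note closed = ring_hom_closed[OF g_hom] ring_hom_closed[OF gf, simplified]
  interpret tensor_factors A B C ?M ?N
    by (intro tensor_factors.intro bimodule_ring_bimod id_ring_hom g_hom gf
        A.ring_axioms B.ring_axioms C.ring_axioms)
  have "(\<Sum>i<n. frag_of (x \<otimes>\<^bsub>A\<^esub> \<pi> i y \<otimes>\<^bsub>A\<^esub> v i, u i)) - frag_of (x, y) \<in> ?J"
    if x: "x \<in> carrier A" and y: "y \<in> carrier A" for x y
  proof (rule J_sum_trans)
    fix i assume i: "i < n"
    then obtain b where b: "b \<in> carrier B" "\<pi> i y \<otimes>\<^bsub>A\<^esub> v i = g b"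
      using \<pi>_v y by blast
    \<comment> \<open>The coefficient \<open>b\<close> can now cross the tensor sign and be absorbed
      into \<open>u i\<close>.\<close>
    have "g b \<otimes>\<^bsub>A\<^esub> u i = \<pi> i y"
      using i y by (simp flip: b(2) add: A.m_assoc vu u v \<pi>)
    then show "frag_of (x \<otimes>\<^bsub>A\<^esub> \<pi> i y \<otimes>\<^bsub>A\<^esub> v i, u i) - frag_of (x, \<pi> i y) \<in> ?J"
      using J_balanced[of x b "u i"] b i x y by (simp add: ring_bimod_simps A.m_assoc u v \<pi>)
  next
    show "(\<Sum>i<n. frag_of (x, \<pi> i y)) - frag_of (x, y) \<in> ?J"
      using J_finprod_right[of n "\<lambda>i. \<pi> i y" x] that \<pi> \<pi>_sum
      by (simp add: ring_bimod_simps finprod_ring_bimod)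
  qed
  moreover have "bimodule A C ?P"
    by (intro bimodule_ring_bimod id_ring_hom gf A.ring_axioms C.ring_axioms)
  moreover have "frag_of ((a \<oplus>\<^bsub>A\<^esub> b) \<otimes>\<^bsub>A\<^esub> v i, u i) - frag_of (a \<otimes>\<^bsub>A\<^esub> v i, u i) - frag_of (b \<otimes>\<^bsub>A\<^esub> v i, u i) \<in> ?J"
    if "a \<in> carrier A" "b \<in> carrier A" "i < n" for a b i
    using J_add_left[of "a \<otimes>\<^bsub>A\<^esub> v i" "b \<otimes>\<^bsub>A\<^esub> v i" "u i"] that u v
    by (simp add: ring_bimod_simps A.l_distr)
  ultimately have "iso_to_direct_summand A C (tensor_bimod B ?M ?N) (power_bimod ?P n)"
    by (intro iso_to_power_summand[where \<phi> = "\<lambda>i x y. x \<otimes>\<^bsub>A\<^esub> \<pi> i y"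
          and p = "\<lambda>i a. a \<otimes>\<^bsub>A\<^esub> v i" and q = "\<lambda>i a. u i"])
      (simp_all add: ring_bimod_simps \<pi> u v \<pi>_add \<pi>_left \<pi>_right \<pi>_u vu closed
        A.m_assoc A.l_distr A.r_distr)
  then show ?thesis
    using \<open>n > 0\<close> unfolding right_depth_three_def by blast
qed

text \<open>The mirror image: \<open>\<pi> i x\<close> is \<open>u i\<close> times the coefficient
  \<open>v i \<otimes> \<pi> i x\<close> from the image of \<open>B\<close>, which crosses the
  tensor sign from the right factor to the left one. Here \<open>a\<close> in slot \<open>i\<close>
  comes from \<open>u i\<close> tensored with \<open>v i a\<close>.\<close>

lemma (in ring_tower) left_depth_threeI:
  assumes "(n :: nat) > 0"
    and \<pi>: "\<And>i x. i < n \<Longrightarrow> x \<in> carrier A \<Longrightarrow> \<pi> i x \<in> carrier A"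
    and \<pi>_add: "\<And>i x y. i < n \<Longrightarrow> x \<in> carrier A \<Longrightarrow> y \<in> carrier A \<Longrightarrow>
      \<pi> i (x \<oplus>\<^bsub>A\<^esub> y) = \<pi> i x \<oplus>\<^bsub>A\<^esub> \<pi> i y"
    and \<pi>_right: "\<And>i b x. i < n \<Longrightarrow> b \<in> carrier B \<Longrightarrow> x \<in> carrier A \<Longrightarrow>
      \<pi> i (x \<otimes>\<^bsub>A\<^esub> g b) = \<pi> i x \<otimes>\<^bsub>A\<^esub> g b"
    and \<pi>_left: "\<And>i c x. i < n \<Longrightarrow> c \<in> carrier C \<Longrightarrow> x \<in> carrier A \<Longrightarrow>
      \<pi> i (g (f c) \<otimes>\<^bsub>A\<^esub> x) = g (f c) \<otimes>\<^bsub>A\<^esub> \<pi> i x"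
    and u: "\<And>i. i < n \<Longrightarrow> u i \<in> carrier A" and v: "\<And>i. i < n \<Longrightarrow> v i \<in> carrier A"
    and uv: "\<And>i. i < n \<Longrightarrow> u i \<otimes>\<^bsub>A\<^esub> v i = \<one>\<^bsub>A\<^esub>"
    and \<pi>_u: "\<And>i j. i < n \<Longrightarrow> j < n \<Longrightarrow> \<pi> j (u i) = (if i = j then u i else \<zero>\<^bsub>A\<^esub>)"
    and \<pi>_v: "\<And>i x. i < n \<Longrightarrow> x \<in> carrier A \<Longrightarrow> v i \<otimes>\<^bsub>A\<^esub> \<pi> i x \<in> g ` carrier B"
    and \<pi>_sum: "\<And>x. x \<in> carrier A \<Longrightarrow> (\<Oplus>\<^bsub>A\<^esub>i\<in>{..<n}. \<pi> i x) = x"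
  shows "left_depth_three A B C g f"
proof -
  let ?M = "ring_bimod A (g \<circ> f) g" and ?N = "ring_bimod A g id" and ?P = "ring_bimod A (g \<circ> f) id"
  let ?J = "tensor_kernel B ?M ?N"
  have gf: "g \<circ> f \<in> ring_hom C A"
    using f_hom g_hom by (rule ring_hom_trans)
  note closed = ring_hom_closed[OF g_hom] ring_hom_closed[OF gf, simplified]
  interpret tensor_factors C B A ?M ?N
    by (intro tensor_factors.intro bimodule_ring_bimod id_ring_hom g_hom gf
        A.ring_axioms B.ring_axioms C.ring_axioms)
  have "(\<Sum>i<n. frag_of (u i, v i \<otimes>\<^bsub>A\<^esub> (\<pi> i x \<otimes>\<^bsub>A\<^esub> y))) - frag_of (x, y) \<in> ?J"
    if x: "x \<in> carrier A" and y: "y \<in> carrier A" for x y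
  proof (rule J_sum_trans)
    fix i assume i: "i < n"
    then obtain b where b: "b \<in> carrier B" "v i \<otimes>\<^bsub>A\<^esub> \<pi> i x = g b"
      using \<pi>_v x by blast
    have "u i \<otimes>\<^bsub>A\<^esub> g b = \<pi> i x"
      using i x by (simp flip: b(2) add: A.m_assoc[symmetric] uv u v \<pi>)
    moreover have "v i \<otimes>\<^bsub>A\<^esub> (\<pi> i x \<otimes>\<^bsub>A\<^esub> y) = g b \<otimes>\<^bsub>A\<^esub> y"
      using i x y by (simp flip: b(2) add: A.m_assoc v \<pi>)
    ultimately show "frag_of (u i, v i \<otimes>\<^bsub>A\<^esub> (\<pi> i x \<otimes>\<^bsub>A\<^esub> y)) - frag_of (\<pi> i x, y) \<in> ?J"
      using J_uminus[OF J_balanced[of "u i" b y]] b i x y by (simp add: ring_bimod_simps u)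
  next
    show "(\<Sum>i<n. frag_of (\<pi> i x, y)) - frag_of (x, y) \<in> ?J"
      using J_finprod_left[of n "\<lambda>i. \<pi> i x" y] that \<pi> \<pi>_sum
      by (simp add: ring_bimod_simps finprod_ring_bimod)
  qed
  moreover have "bimodule C A ?P"
    by (intro bimodule_ring_bimod id_ring_hom gf A.ring_axioms C.ring_axioms)
  moreover have "frag_of (u i, v i \<otimes>\<^bsub>A\<^esub> (a \<oplus>\<^bsub>A\<^esub> b)) - frag_of (u i, v i \<otimes>\<^bsub>A\<^esub> a) - frag_of (u i, v i \<otimes>\<^bsub>A\<^esub> b) \<in> ?J"
    if "a \<in> carrier A" "b \<in> carrier A" "i < n" for a b i
    using J_add_right[of "u i" "v i \<otimes>\<^bsub>A\<^esub> a" "v i \<otimes>\<^bsub>A\<^esub> b"] that u v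
    by (simp add: ring_bimod_simps A.r_distr)
  ultimately have "iso_to_direct_summand C A (tensor_bimod B ?M ?N) (power_bimod ?P n)"
    by (intro iso_to_power_summand[where \<phi> = "\<lambda>i x y. \<pi> i x \<otimes>\<^bsub>A\<^esub> y"
          and p = "\<lambda>i a. u i" and q = "\<lambda>i a. v i \<otimes>\<^bsub>A\<^esub> a"])
      (simp_all add: ring_bimod_simps \<pi> u v \<pi>_add \<pi>_left \<pi>_right \<pi>_u uv closed
        A.m_assoc[symmetric] A.l_distr A.r_distr)
  then show ?thesis
    using \<open>n > 0\<close> unfolding left_depth_three_def by blast
qed

section \<open>Group algebras of finite groups\<close>

text \<open>Interchange of finite sums, by induction on the outer index set; associativity of
  convolution rests on it.\<close>

lemma (in abelian_monoid) finsum_swap: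
  assumes "finite I" "finite J" and f: "\<And>i j. i \<in> I \<Longrightarrow> j \<in> J \<Longrightarrow> f i j \<in> carrier G"
  shows "(\<Oplus>i\<in>I. \<Oplus>j\<in>J. f i j) = (\<Oplus>j\<in>J. \<Oplus>i\<in>I. f i j)"
  using assms(1) f
proof (induction I)
  case empty
  then show ?case by simp
next
  case (insert i I)
  then have "(\<Oplus>j\<in>J. f i j \<oplus> (\<Oplus>i\<in>I. f i j)) = (\<Oplus>j\<in>J. f i j) \<oplus> (\<Oplus>j\<in>J. \<Oplus>i\<in>I. f i j)"
    by (intro finsum_addf) auto
  moreover have "(\<Oplus>j\<in>J. \<Oplus>i\<in>insert i I. f i j) = (\<Oplus>j\<in>J. f i j \<oplus> (\<Oplus>i\<in>I. f i j))"
    using insert by (intro finsum_cong') (auto intro!: finsum_insert)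
  moreover have "(\<Oplus>i\<in>insert i I. \<Oplus>j\<in>J. f i j) = (\<Oplus>j\<in>J. f i j) \<oplus> (\<Oplus>i\<in>I. \<Oplus>j\<in>J. f i j)"
    using insert by (intro finsum_insert) auto
  ultimately show ?case
    using insert by simp
qed

section \<open>Convolution on a finite group\<close>

locale finite_group_algebra = F: ring F + G: group G
  for F :: "('f, 'k) ring_scheme" and G :: "('g, 'l) monoid_scheme" +
  assumes finite_carrier: "finite (carrier G)"
begin

abbreviation "A \<equiv> group_algebra F G"

text \<open>Finiteness of the group makes the support condition automatic, and the value zero off
  the group lies in \<open>F\<close> as well.\<close>

lemma carrier_iff: "a \<in> carrier A \<longleftrightarrow> (\<forall>x. a x \<in> carrier F) \<and> (\<forall>x. x \<notin> carrier G \<longrightarrow> a x = \<zero>\<^bsub>F\<^esub>)"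
proof -
  have "finite {x. a x \<noteq> \<zero>\<^bsub>F\<^esub>}" if "\<And>x. x \<notin> carrier G \<Longrightarrow> a x = \<zero>\<^bsub>F\<^esub>"
    using that by (intro finite_subset[OF _ finite_carrier]) auto
  then show ?thesis
    unfolding group_algebra_def by simp (metis F.zero_closed)
qed

lemma apply_closed: "a \<in> carrier A \<Longrightarrow> a x \<in> carrier F"
  by (simp add: carrier_iff)

lemma add_apply: "(a \<oplus>\<^bsub>A\<^esub> b) x = a x \<oplus>\<^bsub>F\<^esub> b x"
  by (simp add: group_algebra_def)

lemma zero_apply: "\<zero>\<^bsub>A\<^esub> x = \<zero>\<^bsub>F\<^esub>"
  by (simp add: group_algebra_def)

text \<open>Terms outside the support of \<open>a\<close> vanish. Summing over the whole group gives
  all products the same index set, so that sums can be added, swapped and reindexed.\<close>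

lemma mult_apply:
  assumes "a \<in> carrier A" "b \<in> carrier A" "x \<in> carrier G"
  shows "(a \<otimes>\<^bsub>A\<^esub> b) x = (\<Oplus>\<^bsub>F\<^esub>y\<in>carrier G. a y \<otimes>\<^bsub>F\<^esub> b (inv\<^bsub>G\<^esub> y \<otimes>\<^bsub>G\<^esub> x))"
proof -
  have "(\<Oplus>\<^bsub>F\<^esub>y\<in>{y \<in> carrier G. a y \<noteq> \<zero>\<^bsub>F\<^esub>}. a y \<otimes>\<^bsub>F\<^esub> b (inv\<^bsub>G\<^esub> y \<otimes>\<^bsub>G\<^esub> x))
      = (\<Oplus>\<^bsub>F\<^esub>y\<in>carrier G. a y \<otimes>\<^bsub>F\<^esub> b (inv\<^bsub>G\<^esub> y \<otimes>\<^bsub>G\<^esub> x))"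
    by (rule F.add.finprod_mono_neutral_cong_left)
      (use assms finite_carrier in \<open>auto simp: apply_closed\<close>)
  then show ?thesis
    using assms(3) by (simp add: group_algebra_def)
qed

lemma mult_outside: "x \<notin> carrier G \<Longrightarrow> (a \<otimes>\<^bsub>A\<^esub> b) x = \<zero>\<^bsub>F\<^esub>"
  by (simp add: group_algebra_def)

lemma mult_closed: "a \<in> carrier A \<Longrightarrow> b \<in> carrier A \<Longrightarrow> a \<otimes>\<^bsub>A\<^esub> b \<in> carrier A"
  unfolding carrier_iff[of "a \<otimes>\<^bsub>A\<^esub> b"]
  by (metis (no_types, lifting) F.finsum_closed F.m_closed F.zero_closed Pi_I apply_closed
      mult_apply mult_outside)

lemma eqI: "a \<in> carrier A \<Longrightarrow> b \<in> carrier A \<Longrightarrow> (\<And>x. x \<in> carrier G \<Longrightarrow> a x = b x) \<Longrightarrow> a = b"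
  unfolding carrier_iff fun_eq_iff by metis

text \<open>Left translation by \<open>z\<close> permutes the group.\<close>

lemma finsum_translate:
  assumes "f \<in> carrier G \<rightarrow> carrier F" "z \<in> carrier G"
  shows "(\<Oplus>\<^bsub>F\<^esub>y\<in>carrier G. f y) = (\<Oplus>\<^bsub>F\<^esub>y\<in>carrier G. f (z \<otimes>\<^bsub>G\<^esub> y))"
  using F.finsum_reindex[of f "\<lambda>y. z \<otimes>\<^bsub>G\<^esub> y" "carrier G"] assms
    G.inj_on_cmult[of z] G.surj_const_mult[of z] by simp

lemma mult_assoc:
  assumes "a \<in> carrier A" "b \<in> carrier A" "c \<in> carrier A"
  shows "a \<otimes>\<^bsub>A\<^esub> b \<otimes>\<^bsub>A\<^esub> c = a \<otimes>\<^bsub>A\<^esub> (b \<otimes>\<^bsub>A\<^esub> c)"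
proof (rule eqI)
  fix x assume x: "x \<in> carrier G"
  note cl = apply_closed[OF assms(1)] apply_closed[OF assms(2)] apply_closed[OF assms(3)]
  let ?t = "\<lambda>y z. a z \<otimes>\<^bsub>F\<^esub> b (inv\<^bsub>G\<^esub> z \<otimes>\<^bsub>G\<^esub> y) \<otimes>\<^bsub>F\<^esub> c (inv\<^bsub>G\<^esub> y \<otimes>\<^bsub>G\<^esub> x)"
  have "(a \<otimes>\<^bsub>A\<^esub> b \<otimes>\<^bsub>A\<^esub> c) x = (\<Oplus>\<^bsub>F\<^esub>y\<in>carrier G. \<Oplus>\<^bsub>F\<^esub>z\<in>carrier G. ?t y z)"
    unfolding mult_apply[OF mult_closed[OF assms(1,2)] assms(3) x]
    by (intro F.finsum_cong') (use assms finite_carrier in \<open>auto simp: mult_apply F.finsum_ldistr cl\<close>)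
  also have "\<dots> = (\<Oplus>\<^bsub>F\<^esub>z\<in>carrier G. \<Oplus>\<^bsub>F\<^esub>y\<in>carrier G. ?t y z)"
    by (rule F.finsum_swap) (simp_all add: finite_carrier cl)
  also have "\<dots> = (\<Oplus>\<^bsub>F\<^esub>z\<in>carrier G. a z \<otimes>\<^bsub>F\<^esub> (b \<otimes>\<^bsub>A\<^esub> c) (inv\<^bsub>G\<^esub> z \<otimes>\<^bsub>G\<^esub> x))"
  proof (rule F.finsum_cong')
    fix z assume z: "z \<in> carrier G"
    \<comment> \<open>Replacing \<open>y\<close> by \<open>z\<close> times \<open>y\<close> makes
      the argument of \<open>b\<close> free of \<open>z\<close> and leaves the convolution of
      \<open>b\<close> and \<open>c\<close> at the inverse of \<open>z\<close> times
      \<open>x\<close>.\<close>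
    have "(\<Oplus>\<^bsub>F\<^esub>y\<in>carrier G. ?t y z) = (\<Oplus>\<^bsub>F\<^esub>y\<in>carrier G. ?t (z \<otimes>\<^bsub>G\<^esub> y) z)"
      by (rule finsum_translate) (simp_all add: cl z)
    also have "\<dots> = (\<Oplus>\<^bsub>F\<^esub>y\<in>carrier G. a z \<otimes>\<^bsub>F\<^esub> (b y \<otimes>\<^bsub>F\<^esub> c (inv\<^bsub>G\<^esub> y \<otimes>\<^bsub>G\<^esub> (inv\<^bsub>G\<^esub> z \<otimes>\<^bsub>G\<^esub> x))))"
      by (intro F.finsum_cong')
        (use x z in \<open>auto simp: cl F.m_assoc G.inv_mult_group G.m_assoc G.inv_solve_left' simp flip: G.m_assoc[of "inv\<^bsub>G\<^esub> z" z]\<close>)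
    also have "\<dots> = a z \<otimes>\<^bsub>F\<^esub> (b \<otimes>\<^bsub>A\<^esub> c) (inv\<^bsub>G\<^esub> z \<otimes>\<^bsub>G\<^esub> x)"
      using assms x z finite_carrier by (simp add: mult_apply F.finsum_rdistr cl)
    finally show "(\<Oplus>\<^bsub>F\<^esub>y\<in>carrier G. ?t y z) = \<dots>" .
  qed (use assms mult_closed in \<open>auto simp: apply_closed\<close>)
  also have "\<dots> = (a \<otimes>\<^bsub>A\<^esub> (b \<otimes>\<^bsub>A\<^esub> c)) x"
    using assms x by (simp add: mult_apply mult_closed)
  finally show "(a \<otimes>\<^bsub>A\<^esub> b \<otimes>\<^bsub>A\<^esub> c) x = (a \<otimes>\<^bsub>A\<^esub> (b \<otimes>\<^bsub>A\<^esub> c)) x" .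
qed (use assms mult_closed in auto)

section \<open>Group elements as elements of the group algebra\<close>

definition delta :: "'g \<Rightarrow> 'g \<Rightarrow> 'f"
  where "delta u = (\<lambda>x. if x = u then \<one>\<^bsub>F\<^esub> else \<zero>\<^bsub>F\<^esub>)"

lemma delta_closed: "u \<in> carrier G \<Longrightarrow> delta u \<in> carrier A"
  by (auto simp: delta_def carrier_iff)

lemma one_eq_delta: "\<one>\<^bsub>A\<^esub> = delta \<one>\<^bsub>G\<^esub>"
  by (simp add: delta_def group_algebra_def)

lemma delta_mult_apply:
  assumes "u \<in> carrier G" "a \<in> carrier A" "x \<in> carrier G"
  shows "(delta u \<otimes>\<^bsub>A\<^esub> a) x = a (inv\<^bsub>G\<^esub> u \<otimes>\<^bsub>G\<^esub> x)"
proof -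
  have "(delta u \<otimes>\<^bsub>A\<^esub> a) x = (\<Oplus>\<^bsub>F\<^esub>y\<in>carrier G. if u = y then a (inv\<^bsub>G\<^esub> y \<otimes>\<^bsub>G\<^esub> x) else \<zero>\<^bsub>F\<^esub>)"
    unfolding mult_apply[OF delta_closed[OF assms(1)] assms(2,3)]
    by (intro F.finsum_cong') (use assms in \<open>auto simp: delta_def apply_closed\<close>)
  then show ?thesis
    using F.finsum_singleton[of u "carrier G" "\<lambda>y. a (inv\<^bsub>G\<^esub> y \<otimes>\<^bsub>G\<^esub> x)"] assms finite_carrier
    by (simp add: apply_closed)
qed

lemma mult_delta_apply:
  assumes "u \<in> carrier G" "a \<in> carrier A" "x \<in> carrier G"
  shows "(a \<otimes>\<^bsub>A\<^esub> delta u) x = a (x \<otimes>\<^bsub>G\<^esub> inv\<^bsub>G\<^esub> u)"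
proof -
  \<comment> \<open>Identifies the only index \<open>y\<close> that contributes to the
    convolution.\<close>
  have "inv\<^bsub>G\<^esub> y \<otimes>\<^bsub>G\<^esub> x = u \<longleftrightarrow> x \<otimes>\<^bsub>G\<^esub> inv\<^bsub>G\<^esub> u = y" if "y \<in> carrier G" for y
    using that assms by (metis G.inv_closed G.inv_solve_left G.inv_solve_right')
  then have "(a \<otimes>\<^bsub>A\<^esub> delta u) x = (\<Oplus>\<^bsub>F\<^esub>y\<in>carrier G. if x \<otimes>\<^bsub>G\<^esub> inv\<^bsub>G\<^esub> u = y then a y else \<zero>\<^bsub>F\<^esub>)"
    unfolding mult_apply[OF assms(2) delta_closed[OF assms(1)] assms(3)]
    by (intro F.finsum_cong') (use assms in \<open>auto simp: delta_def apply_closed\<close>)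
  then show ?thesis
    using F.finsum_singleton[of "x \<otimes>\<^bsub>G\<^esub> inv\<^bsub>G\<^esub> u" "carrier G" a] assms finite_carrier
    by (simp add: apply_closed)
qed

lemma delta_mult_delta:
  assumes "u \<in> carrier G" "v \<in> carrier G"
  shows "delta u \<otimes>\<^bsub>A\<^esub> delta v = delta (u \<otimes>\<^bsub>G\<^esub> v)"
proof (rule eqI)
  fix x assume "x \<in> carrier G"
  then show "(delta u \<otimes>\<^bsub>A\<^esub> delta v) x = delta (u \<otimes>\<^bsub>G\<^esub> v) x"
    using assms by (auto simp: delta_mult_apply delta_closed) (auto simp: delta_def G.inv_solve_left')
qed (use assms in \<open>auto intro: mult_closed delta_closed\<close>)

lemma ring_group_algebra: "ring A"
proof (rule ringI)
  have "\<exists>b\<in>carrier A. b \<oplus>\<^bsub>A\<^esub> a = \<zero>\<^bsub>A\<^esub>" if "a \<in> carrier A" for a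
    using that
    by (intro bexI[of _ "\<lambda>x. \<ominus>\<^bsub>F\<^esub> a x"]) (auto simp: carrier_iff add_apply zero_apply F.l_neg)
  then show "abelian_group A"
    by (intro abelian_groupI) (auto simp: carrier_iff add_apply zero_apply F.a_ac)
  show "monoid A"
  proof (rule monoidI)
    fix a assume a: "a \<in> carrier A"
    show "\<one>\<^bsub>A\<^esub> \<otimes>\<^bsub>A\<^esub> a = a" "a \<otimes>\<^bsub>A\<^esub> \<one>\<^bsub>A\<^esub> = a"
      using a by (auto intro!: eqI mult_closed delta_closed
          simp: one_eq_delta delta_mult_apply mult_delta_apply)
  qed (simp_all add: mult_closed mult_assoc one_eq_delta delta_closed)
next
  fix a b c assume abc: "a \<in> carrier A" "b \<in> carrier A" "c \<in> carrier A"
  then have ab: "a \<oplus>\<^bsub>A\<^esub> b \<in> carrier A"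
    and s: "a \<otimes>\<^bsub>A\<^esub> c \<oplus>\<^bsub>A\<^esub> b \<otimes>\<^bsub>A\<^esub> c \<in> carrier A" "c \<otimes>\<^bsub>A\<^esub> a \<oplus>\<^bsub>A\<^esub> c \<otimes>\<^bsub>A\<^esub> b \<in> carrier A"
    using mult_closed[unfolded carrier_iff] by (auto simp: carrier_iff add_apply)
  show "(a \<oplus>\<^bsub>A\<^esub> b) \<otimes>\<^bsub>A\<^esub> c = a \<otimes>\<^bsub>A\<^esub> c \<oplus>\<^bsub>A\<^esub> b \<otimes>\<^bsub>A\<^esub> c"
    by (rule eqI[OF mult_closed[OF ab abc(3)] s(1)])
      (use abc ab in \<open>simp add: mult_apply add_apply F.l_distr apply_closed flip: F.finsum_addf\<close>)
  show "c \<otimes>\<^bsub>A\<^esub> (a \<oplus>\<^bsub>A\<^esub> b) = c \<otimes>\<^bsub>A\<^esub> a \<oplus>\<^bsub>A\<^esub> c \<otimes>\<^bsub>A\<^esub> b"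
    by (rule eqI[OF mult_closed[OF abc(3) ab] s(2)])
      (use abc ab in \<open>simp add: mult_apply add_apply F.r_distr apply_closed flip: F.finsum_addf\<close>)
qed

sublocale A: ring A
  by (rule ring_group_algebra)

lemma finsum_apply:
  assumes "finite I" "\<And>i. i \<in> I \<Longrightarrow> f i \<in> carrier A"
  shows "(\<Oplus>\<^bsub>A\<^esub>i\<in>I. f i) x = (\<Oplus>\<^bsub>F\<^esub>i\<in>I. f i x)"
  using assms
proof (induction I)
  case empty
  then show ?case by (simp add: zero_apply)
next
  case (insert i I)
  then show ?case by (simp add: add_apply apply_closed Pi_def)
qed

section \<open>Restricting supports to subsets of the group\<close>

definition cut :: "'g set \<Rightarrow> ('g \<Rightarrow> 'f) \<Rightarrow> 'g \<Rightarrow> 'f"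
  where "cut D a = (\<lambda>x. if x \<in> D then a x else \<zero>\<^bsub>F\<^esub>)"

lemma cut_closed: "a \<in> carrier A \<Longrightarrow> cut D a \<in> carrier A"
  by (auto simp: cut_def carrier_iff)

lemma cut_add: "cut D (a \<oplus>\<^bsub>A\<^esub> b) = cut D a \<oplus>\<^bsub>A\<^esub> cut D b"
  by (auto simp: cut_def add_apply)

lemma cut_delta: "cut D (delta u) = (if u \<in> D then delta u else \<zero>\<^bsub>A\<^esub>)"
  by (auto simp: cut_def delta_def zero_apply)

text \<open>In the convolution at \<open>x\<close> only those \<open>y\<close> in the support of
  \<open>b\<close> count, and for them \<open>D\<close> contains \<open>x\<close> exactly when it
  contains the inverse of \<open>y\<close> times \<open>x\<close>. Stability of \<open>D\<close> is
  asked for the support of \<open>b\<close> alone, so that one lemma serves for factors from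
  \<open>B\<close> as well as from \<open>C\<close>.\<close>

lemma cut_mult_left:
  assumes a: "a \<in> carrier A" and b: "b \<in> carrier A"
    and D: "\<And>y x. y \<in> carrier G \<Longrightarrow> b y \<noteq> \<zero>\<^bsub>F\<^esub> \<Longrightarrow> x \<in> carrier G \<Longrightarrow> y \<otimes>\<^bsub>G\<^esub> x \<in> D \<longleftrightarrow> x \<in> D"
  shows "cut D (b \<otimes>\<^bsub>A\<^esub> a) = b \<otimes>\<^bsub>A\<^esub> cut D a"
proof (rule eqI)
  fix x assume x: "x \<in> carrier G"
  have "inv\<^bsub>G\<^esub> y \<otimes>\<^bsub>G\<^esub> x \<in> D \<longleftrightarrow> x \<in> D" if "y \<in> carrier G" "b y \<noteq> \<zero>\<^bsub>F\<^esub>" for y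
    using D[OF that, of "inv\<^bsub>G\<^esub> y \<otimes>\<^bsub>G\<^esub> x"] that x by (simp flip: G.m_assoc)
  then have "b y \<otimes>\<^bsub>F\<^esub> cut D a (inv\<^bsub>G\<^esub> y \<otimes>\<^bsub>G\<^esub> x)
      = (if x \<in> D then b y \<otimes>\<^bsub>F\<^esub> a (inv\<^bsub>G\<^esub> y \<otimes>\<^bsub>G\<^esub> x) else \<zero>\<^bsub>F\<^esub>)" if "y \<in> carrier G" for y
    using that a b by (cases "b y = \<zero>\<^bsub>F\<^esub>") (simp_all add: cut_def apply_closed)
  then have "(\<Oplus>\<^bsub>F\<^esub>y\<in>carrier G. b y \<otimes>\<^bsub>F\<^esub> cut D a (inv\<^bsub>G\<^esub> y \<otimes>\<^bsub>G\<^esub> x))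
      = (\<Oplus>\<^bsub>F\<^esub>y\<in>carrier G. if x \<in> D then b y \<otimes>\<^bsub>F\<^esub> a (inv\<^bsub>G\<^esub> y \<otimes>\<^bsub>G\<^esub> x) else \<zero>\<^bsub>F\<^esub>)"
    by (intro F.finsum_cong') (use a b x in \<open>auto simp: apply_closed\<close>)
  then show "cut D (b \<otimes>\<^bsub>A\<^esub> a) x = (b \<otimes>\<^bsub>A\<^esub> cut D a) x"
    unfolding mult_apply[OF b cut_closed[OF a] x] using mult_apply[OF b a x] by (simp add: cut_def)
qed (use a b in \<open>simp_all add: cut_closed\<close>)

text \<open>Here the element of the support of \<open>b\<close> is the inverse of \<open>y\<close>
  times \<open>x\<close>; right multiplication by it takes \<open>y\<close> to
  \<open>x\<close>.\<close>

lemma cut_mult_right: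
  assumes a: "a \<in> carrier A" and b: "b \<in> carrier A"
    and D: "\<And>y x. y \<in> carrier G \<Longrightarrow> b y \<noteq> \<zero>\<^bsub>F\<^esub> \<Longrightarrow> x \<in> carrier G \<Longrightarrow> x \<otimes>\<^bsub>G\<^esub> y \<in> D \<longleftrightarrow> x \<in> D"
  shows "cut D (a \<otimes>\<^bsub>A\<^esub> b) = cut D a \<otimes>\<^bsub>A\<^esub> b"
proof (rule eqI)
  fix x assume x: "x \<in> carrier G"
  have "y \<in> D \<longleftrightarrow> x \<in> D" if "y \<in> carrier G" "b (inv\<^bsub>G\<^esub> y \<otimes>\<^bsub>G\<^esub> x) \<noteq> \<zero>\<^bsub>F\<^esub>" for y
    using D[OF _ that(2) that(1)] that x by (simp flip: G.m_assoc)
  then have "cut D a y \<otimes>\<^bsub>F\<^esub> b (inv\<^bsub>G\<^esub> y \<otimes>\<^bsub>G\<^esub> x)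
      = (if x \<in> D then a y \<otimes>\<^bsub>F\<^esub> b (inv\<^bsub>G\<^esub> y \<otimes>\<^bsub>G\<^esub> x) else \<zero>\<^bsub>F\<^esub>)" if "y \<in> carrier G" for y
    using that a b by (cases "b (inv\<^bsub>G\<^esub> y \<otimes>\<^bsub>G\<^esub> x) = \<zero>\<^bsub>F\<^esub>") (simp_all add: cut_def apply_closed)
  then have "(\<Oplus>\<^bsub>F\<^esub>y\<in>carrier G. cut D a y \<otimes>\<^bsub>F\<^esub> b (inv\<^bsub>G\<^esub> y \<otimes>\<^bsub>G\<^esub> x))
      = (\<Oplus>\<^bsub>F\<^esub>y\<in>carrier G. if x \<in> D then a y \<otimes>\<^bsub>F\<^esub> b (inv\<^bsub>G\<^esub> y \<otimes>\<^bsub>G\<^esub> x) else \<zero>\<^bsub>F\<^esub>)"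
    by (intro F.finsum_cong') (use a b x in \<open>auto simp: apply_closed\<close>)
  then show "cut D (a \<otimes>\<^bsub>A\<^esub> b) x = (cut D a \<otimes>\<^bsub>A\<^esub> b) x"
    unfolding mult_apply[OF cut_closed[OF a] b x] using mult_apply[OF a b x] by (simp add: cut_def)
qed (use a b in \<open>simp_all add: cut_closed\<close>)

text \<open>The sets \<open>D i\<close> partition the group, so at each point exactly one summand
  survives.\<close>

lemma finsum_cut:
  assumes a: "a \<in> carrier A" and "finite I"
    and D: "\<And>x. x \<in> carrier G \<Longrightarrow> \<exists>!i. i \<in> I \<and> x \<in> D i"
  shows "(\<Oplus>\<^bsub>A\<^esub>i\<in>I. cut (D i) a) = a"
proof (rule eqI)
  fix x assume "x \<in> carrier G"
  then obtain k where k: "k \<in> I" "\<And>i. i \<in> I \<Longrightarrow> x \<in> D i \<longleftrightarrow> k = i"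
    using D by metis
  then have "(\<Oplus>\<^bsub>F\<^esub>i\<in>I. cut (D i) a x) = (\<Oplus>\<^bsub>F\<^esub>i\<in>I. if k = i then a x else \<zero>\<^bsub>F\<^esub>)"
    using a by (intro F.finsum_cong') (simp_all add: cut_def apply_closed)
  also have "\<dots> = a x"
    using F.finsum_singleton[of k I "\<lambda>_. a x"] k(1) a \<open>finite I\<close> by (simp add: apply_closed)
  finally show "(\<Oplus>\<^bsub>A\<^esub>i\<in>I. cut (D i) a) x = a x"
    using a \<open>finite I\<close> by (simp add: finsum_apply cut_closed)
qed (use a in \<open>auto intro: A.finsum_closed simp: cut_closed\<close>)

section \<open>Group algebras of subgroups\<close>

lemma finite_group_algebra_subgroup:
  assumes "subgroup H G"
  shows "finite_group_algebra F (G\<lparr>carrier := H\<rparr>)"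
proof -
  interpret H: group "G\<lparr>carrier := H\<rparr>"
    using assms by (rule G.subgroup_imp_group)
  show ?thesis
    by unfold_locales (use finite_subset[OF subgroup.subset[OF assms] finite_carrier] in simp)
qed

lemma carrier_subgroup_algebra:
  assumes "subgroup H G"
  shows "carrier (group_algebra F (G\<lparr>carrier := H\<rparr>)) = {a \<in> carrier A. \<forall>x. x \<notin> H \<longrightarrow> a x = \<zero>\<^bsub>F\<^esub>}"
proof -
  interpret H: finite_group_algebra F "G\<lparr>carrier := H\<rparr>"
    using assms by (rule finite_group_algebra_subgroup)
  show ?thesis
    using subgroup.subset[OF assms] by (fastforce simp: H.carrier_iff carrier_iff)
qed

text \<open>Only multiplication needs an argument. For \<open>a\<close> supported on
  \<open>H\<close> the convolution over \<open>G\<close> is a sum over \<open>H\<close>. At points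
  of \<open>H\<close> it is the convolution of \<open>H\<close>; at other points both products
  vanish.\<close>

lemma subgroup_algebra_hom:
  assumes H: "subgroup H G"
  shows "id \<in> ring_hom (group_algebra F (G\<lparr>carrier := H\<rparr>)) A"
proof -
  let ?B = "group_algebra F (G\<lparr>carrier := H\<rparr>)"
  interpret H: finite_group_algebra F "G\<lparr>carrier := H\<rparr>"
    using H by (rule finite_group_algebra_subgroup)
  have sub: "carrier ?B \<subseteq> carrier A"
    by (auto simp: carrier_subgroup_algebra[OF H])
  have "a \<otimes>\<^bsub>?B\<^esub> b = a \<otimes>\<^bsub>A\<^esub> b" if ab: "a \<in> carrier ?B" "b \<in> carrier ?B" for a b
  proof (rule eqI)
    fix x assume x: "x \<in> carrier G"
    have a: "a \<in> carrier A" "\<And>y. y \<notin> H \<Longrightarrow> a y = \<zero>\<^bsub>F\<^esub>" and b: "b \<in> carrier A" "\<And>y. y \<notin> H \<Longrightarrow> b y = \<zero>\<^bsub>F\<^esub>"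
      using ab by (auto simp: carrier_subgroup_algebra[OF H])
    have "(\<Oplus>\<^bsub>F\<^esub>y\<in>H. a y \<otimes>\<^bsub>F\<^esub> b (inv\<^bsub>G\<^esub> y \<otimes>\<^bsub>G\<^esub> x)) = (a \<otimes>\<^bsub>A\<^esub> b) x"
      unfolding mult_apply[OF a(1) b(1) x]
      by (rule F.add.finprod_mono_neutral_cong_left)
        (use a b finite_carrier subgroup.subset[OF H] in \<open>auto simp: apply_closed\<close>)
    moreover have "(\<Oplus>\<^bsub>F\<^esub>y\<in>H. a y \<otimes>\<^bsub>F\<^esub> b (inv\<^bsub>G\<^esub> y \<otimes>\<^bsub>G\<^esub> x)) = (a \<otimes>\<^bsub>?B\<^esub> b) x"
    proof (cases "x \<in> H")
      case True
      then show ?thesis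
        unfolding H.mult_apply[OF ab, simplified, OF True]
        by (intro F.finsum_cong') (use a b H in \<open>auto simp: apply_closed\<close>)
    next
      case False
      \<comment> \<open>Otherwise \<open>x\<close>, as \<open>y\<close> times this element, would
        lie in \<open>H\<close>. So \<open>b\<close> vanishes here.\<close>
      have "inv\<^bsub>G\<^esub> y \<otimes>\<^bsub>G\<^esub> x \<notin> H" if "y \<in> H" for y
        using that False x subgroup.m_closed[OF H that, of "inv\<^bsub>G\<^esub> y \<otimes>\<^bsub>G\<^esub> x"] subgroup.mem_carrier[OF H that]
        by (auto simp flip: G.m_assoc)
      then have "(\<Oplus>\<^bsub>F\<^esub>y\<in>H. a y \<otimes>\<^bsub>F\<^esub> b (inv\<^bsub>G\<^esub> y \<otimes>\<^bsub>G\<^esub> x)) = (\<Oplus>\<^bsub>F\<^esub>y\<in>H. \<zero>\<^bsub>F\<^esub>)"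
        by (intro F.finsum_cong') (use a b in \<open>auto simp: apply_closed\<close>)
      then show ?thesis
        using False H.mult_outside[of x a b] by simp
    qed
    ultimately show "(a \<otimes>\<^bsub>?B\<^esub> b) x = (a \<otimes>\<^bsub>A\<^esub> b) x" by simp
  qed (use sub ab H.A.m_closed in auto)
  then show ?thesis
    using sub by (intro ring_hom_memI) (auto simp: add_apply H.add_apply one_eq_delta H.one_eq_delta delta_def H.delta_def)
qed

end

section \<open>Cosets and normal closure\<close>

lemma (in group) subgroup_mult_left_iff:
  assumes "subgroup H G" "h \<in> H" "x \<in> carrier G"
  shows "h \<otimes> x \<in> H \<longleftrightarrow> x \<in> H"
proof
  assume "h \<otimes> x \<in> H"
  then have "inv h \<otimes> (h \<otimes> x) \<in> H"
    by (rule subgroup.m_closed[OF assms(1) subgroup.m_inv_closed[OF assms(1,2)]])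
  then show "x \<in> H"
    using assms subgroup.mem_carrier[OF assms(1,2)] by (simp flip: m_assoc)
qed (rule subgroup.m_closed[OF assms(1,2)])

lemma (in group) subgroup_mult_right_iff:
  assumes "subgroup H G" "h \<in> H" "x \<in> carrier G"
  shows "x \<otimes> h \<in> H \<longleftrightarrow> x \<in> H"
proof
  assume "x \<otimes> h \<in> H"
  then have "x \<otimes> h \<otimes> inv h \<in> H"
    by (rule subgroup.m_closed[OF assms(1) _ subgroup.m_inv_closed[OF assms(1,2)]])
  then show "x \<in> H"
    using assms subgroup.mem_carrier[OF assms(1,2)] by (simp add: m_assoc)
qed (rule subgroup.m_closed[OF assms(1) _ assms(2)])

text \<open>The finitely many right cosets are numbered and a representative \<open>u i\<close> is
  chosen in each. Membership of \<open>x\<close> in the coset of \<open>u i\<close> is written as a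
  condition on \<open>x\<close> times the inverse of \<open>u i\<close>, the form used for
  supports.\<close>

lemma (in group) right_transversal:
  assumes "finite (carrier G)" and H: "subgroup H G"
  obtains n :: nat and u where "n > 0" "\<And>i. i < n \<Longrightarrow> u i \<in> carrier G"
    "\<And>x. x \<in> carrier G \<Longrightarrow> \<exists>!i. i < n \<and> x \<otimes> inv u i \<in> H"
proof -
  have rc: "rcosets H = (\<lambda>x. H #> x) ` carrier G"
    by (auto simp: RCOSETS_def)
  then have "finite (rcosets H)"
    using assms(1) by simp
  then obtain e where e: "bij_betw e {0..<card (rcosets H)} (rcosets H)"
    using ex_bij_betw_nat_finite by blast
  define n where "n = card (rcosets H)"
  have "\<exists>r. r \<in> carrier G \<and> e i = H #> r" if "i < n" for i
  proof -
    have "e i \<in> rcosets H"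
      using bij_betwE[OF e] that by (simp add: n_def)
    then show ?thesis
      by (auto simp: rc)
  qed
  then obtain u where u: "\<And>i. i < n \<Longrightarrow> u i \<in> carrier G \<and> e i = H #> u i"
    by metis
  have coset_iff: "x \<otimes> inv r \<in> H \<longleftrightarrow> H #> x = H #> r" if "x \<in> carrier G" "r \<in> carrier G" for x r
  proof
    assume "x \<otimes> inv r \<in> H"
    then have "x \<in> H #> r"
      using that by (force simp: r_coset_def m_assoc)
    then show "H #> x = H #> r"
      using repr_independence that H by blast
  next
    assume "H #> x = H #> r"
    then have "x \<in> H #> r"
      using rcos_self[OF that(1) H] by simp
    then show "x \<otimes> inv r \<in> H"
      using that subgroup.mem_carrier[OF H] by (auto simp: r_coset_def m_assoc)
  qed
  have "\<exists>!i. i < n \<and> x \<otimes> inv u i \<in> H" if "x \<in> carrier G" for x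
  proof -
    have "H #> x \<in> rcosets H"
      using that by (auto simp: rc)
    then obtain i where i: "i < n" "e i = H #> x"
      using bij_betw_imp_surj_on[OF e] unfolding n_def by (metis atLeastLessThan_iff imageE)
    have "j = i" if "j < n" "e j = H #> x" for j
      using inj_onD[OF bij_betw_imp_inj_on[OF e], of j i] that i by (simp add: n_def)
    then have "\<exists>!i. i < n \<and> e i = H #> x"
      using i by blast
    then show ?thesis
      using u that by (metis coset_iff)
  qed
  moreover have "n > 0"
    \<comment> \<open>The identity lies in some coset, so there is an index below
      \<open>n\<close>.\<close>
    using calculation[OF one_closed] by auto
  ultimately show thesis
    using that u by blast
qed

text \<open>Every normal subgroup containing \<open>K\<close> contains the conjugate, hence so does
  their intersection.\<close>

lemma (in group) conj_mem_normal_closure: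
  "x \<in> carrier G \<Longrightarrow> k \<in> K \<Longrightarrow> x \<otimes> k \<otimes> inv x \<in> normal_closure G K"
  unfolding normal_closure_def using normal.inv_op_closed2 by fastforce

section \<open>Coset projections for the tower of group algebras\<close>

theorem theorem3p1:
  fixes F :: "('f, 'k) ring_scheme" and G :: "('g, 'l) monoid_scheme" and H K :: "'g set"
  assumes "ring F"
    and "group G" and "finite (carrier G)"
    and "subgroup H G" and "subgroup K (G\<lparr>carrier := H\<rparr>)"
    and "normal_closure G K \<subseteq> H"
  defines "A \<equiv> group_algebra F G"
    and "B \<equiv> group_algebra F (G\<lparr>carrier := H\<rparr>)"
    and "C \<equiv> group_algebra F (G\<lparr>carrier := K\<rparr>)"
  shows "ring_tower A B C id id \<and> depth_three A B C id id"
proof -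
  interpret GA: finite_group_algebra F G
    using assms(1-3) by (intro finite_group_algebra.intro finite_group_algebra_axioms.intro)
  interpret HA: finite_group_algebra F "G\<lparr>carrier := H\<rparr>"
    using assms(4) by (rule GA.finite_group_algebra_subgroup)
  interpret KA: finite_group_algebra F "G\<lparr>carrier := K\<rparr>"
    using HA.finite_group_algebra_subgroup[OF assms(5)] by simp
  note H = assms(4)
  have K: "K \<subseteq> H" "subgroup K G"
    using subgroup.subset[OF assms(5)] GA.G.incl_subgroup[OF H assms(5)] by auto
  \<comment> \<open>The form in which the hypothesis on the normal closure enters: conjugates of
    \<open>K\<close> by all elements of \<open>G\<close> stay in \<open>H\<close>.\<close>
  have conj: "x \<otimes>\<^bsub>G\<^esub> k \<otimes>\<^bsub>G\<^esub> inv\<^bsub>G\<^esub> x \<in> H" if "x \<in> carrier G" "k \<in> K" for x k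
    using GA.G.conj_mem_normal_closure[OF that] assms(6) by blast
  have B: "b \<in> carrier B \<longleftrightarrow> b \<in> carrier A \<and> (\<forall>x. x \<notin> H \<longrightarrow> b x = \<zero>\<^bsub>F\<^esub>)" for b
    using GA.carrier_subgroup_algebra[OF H] by (simp add: A_def B_def)
  have C: "c \<in> carrier C \<longleftrightarrow> c \<in> carrier A \<and> (\<forall>x. x \<notin> K \<longrightarrow> c x = \<zero>\<^bsub>F\<^esub>)" for c
    using GA.carrier_subgroup_algebra[OF K(2)] by (simp add: A_def C_def)
  interpret ring_tower A B C id id
    using GA.ring_group_algebra HA.ring_group_algebra KA.ring_group_algebra
      GA.subgroup_algebra_hom[OF H] HA.subgroup_algebra_hom[OF assms(5)]
    by (simp add: A_def B_def C_def ring_tower_def ring_tower_axioms_def)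
  obtain n :: nat and u where n: "n > 0" and u: "\<And>i. i < n \<Longrightarrow> u i \<in> carrier G"
    and cosets: "\<And>x. x \<in> carrier G \<Longrightarrow> \<exists>!i. i < n \<and> x \<otimes>\<^bsub>G\<^esub> inv\<^bsub>G\<^esub> u i \<in> H"
    using GA.G.right_transversal[OF assms(3) H] by blast
  note [simp] = GA.cut_closed GA.cut_add GA.delta_closed GA.delta_mult_delta
    GA.one_eq_delta[symmetric]
  \<comment> \<open>The one coset containing \<open>u i\<close> is its own, because the identity
    lies in \<open>H\<close>. This decides which projections kill which generators.\<close>
  have unique: "u i \<otimes>\<^bsub>G\<^esub> inv\<^bsub>G\<^esub> u j \<in> H \<longleftrightarrow> i = j" if "i < n" "j < n" for i j
    using cosets[OF u[OF that(1)]] that u[OF that(1)] subgroup.one_closed[OF H]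
    by (metis GA.G.r_inv)
  have "right_depth_three A B C id id"
  \<comment> \<open>The set cut out is the right coset \<open>H u\<^sub>i\<close>; the generator is
    \<open>u\<^sub>i\<close> itself, and \<open>v\<close> is its inverse.\<close>
  proof (rule right_depth_threeI[where \<pi> = "\<lambda>i. GA.cut {x \<in> carrier G. x \<otimes>\<^bsub>G\<^esub> inv\<^bsub>G\<^esub> u i \<in> H}"
        and u = "\<lambda>i. GA.delta (u i)" and v = "\<lambda>i. GA.delta (inv\<^bsub>G\<^esub> u i)", OF n])
    fix i x assume i: "i < n" and x: "x \<in> carrier A"
    let ?D = "{x \<in> carrier G. x \<otimes>\<^bsub>G\<^esub> inv\<^bsub>G\<^esub> u i \<in> H}"
    note ui = u[OF i]
    show "GA.cut ?D (id b \<otimes>\<^bsub>A\<^esub> x) = id b \<otimes>\<^bsub>A\<^esub> GA.cut ?D x" if "b \<in> carrier B" for b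
      unfolding A_def id_apply
    proof (rule GA.cut_mult_left)
      fix y z assume y: "y \<in> carrier G" "b y \<noteq> \<zero>\<^bsub>F\<^esub>" and z: "z \<in> carrier G"
      then have "y \<in> H" using that B by blast
      then show "y \<otimes>\<^bsub>G\<^esub> z \<in> ?D \<longleftrightarrow> z \<in> ?D"
        using y z ui GA.G.subgroup_mult_left_iff[OF H, of y "z \<otimes>\<^bsub>G\<^esub> inv\<^bsub>G\<^esub> u i"]
        by (simp add: GA.G.m_assoc)
    qed (use x that B in \<open>auto simp: A_def\<close>)
    show "GA.cut ?D (x \<otimes>\<^bsub>A\<^esub> id (id c)) = GA.cut ?D x \<otimes>\<^bsub>A\<^esub> id (id c)" if "c \<in> carrier C" for c
      unfolding A_def id_apply
    proof (rule GA.cut_mult_right)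
      fix y z assume y: "y \<in> carrier G" "c y \<noteq> \<zero>\<^bsub>F\<^esub>" and z: "z \<in> carrier G"
      then have "y \<in> K" using that C by blast
      \<comment> \<open>Moving \<open>y\<close> past the inverse of \<open>u i\<close> turns it into
        a conjugate, which \<open>conj\<close> puts in \<open>H\<close>. Hence the right coset is
        stable under right multiplication by \<open>K\<close>.\<close>
      moreover have "z \<otimes>\<^bsub>G\<^esub> y \<otimes>\<^bsub>G\<^esub> inv\<^bsub>G\<^esub> u i
          = z \<otimes>\<^bsub>G\<^esub> inv\<^bsub>G\<^esub> u i \<otimes>\<^bsub>G\<^esub> (u i \<otimes>\<^bsub>G\<^esub> y \<otimes>\<^bsub>G\<^esub> inv\<^bsub>G\<^esub> u i)"
        using y z ui by (simp add: GA.G.m_assoc) (simp flip: GA.G.m_assoc)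
      ultimately show "z \<otimes>\<^bsub>G\<^esub> y \<in> ?D \<longleftrightarrow> z \<in> ?D"
        using y z ui conj[OF ui] GA.G.subgroup_mult_right_iff[OF H, of _ "z \<otimes>\<^bsub>G\<^esub> inv\<^bsub>G\<^esub> u i"]
        by simp
    qed (use x that C in \<open>auto simp: A_def\<close>)
    \<comment> \<open>Multiplying by the inverse of \<open>u i\<close> on the right shifts the
      support from \<open>H u\<^sub>i\<close> into \<open>H\<close>.\<close>
    have "(GA.cut ?D x \<otimes>\<^bsub>A\<^esub> GA.delta (inv\<^bsub>G\<^esub> u i)) z = \<zero>\<^bsub>F\<^esub>" if "z \<notin> H" for z
    proof (cases "z \<in> carrier G")
      case True
      then show ?thesis
        using x ui that by (simp add: A_def GA.mult_delta_apply) (simp add: GA.cut_def GA.G.m_assoc)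
    qed (simp add: A_def GA.mult_outside)
    then show "GA.cut ?D x \<otimes>\<^bsub>A\<^esub> GA.delta (inv\<^bsub>G\<^esub> u i) \<in> id ` carrier B"
      using x ui by (simp add: A_def B GA.mult_closed)
  next
    fix x assume "x \<in> carrier A"
    then show "(\<Oplus>\<^bsub>A\<^esub>i\<in>{..<n}. GA.cut {x \<in> carrier G. x \<otimes>\<^bsub>G\<^esub> inv\<^bsub>G\<^esub> u i \<in> H} x) = x"
      unfolding A_def using cosets by (intro GA.finsum_cut) auto
  qed (use u in \<open>auto simp: A_def GA.cut_delta unique\<close>)
  moreover have "left_depth_three A B C id id"
  \<comment> \<open>The same transversal serves with the roles of \<open>u\<close> and
    \<open>v\<close> exchanged: the inverses of the \<open>u i\<close> represent the left cosets,
    and the set cut out is the one of the inverse of \<open>u i\<close>.\<close>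
  proof (rule left_depth_threeI[where \<pi> = "\<lambda>i. GA.cut {x \<in> carrier G. u i \<otimes>\<^bsub>G\<^esub> x \<in> H}"
        and u = "\<lambda>i. GA.delta (inv\<^bsub>G\<^esub> u i)" and v = "\<lambda>i. GA.delta (u i)", OF n])
    fix i x assume i: "i < n" and x: "x \<in> carrier A"
    let ?D = "{x \<in> carrier G. u i \<otimes>\<^bsub>G\<^esub> x \<in> H}"
    note ui = u[OF i]
    show "GA.cut ?D (x \<otimes>\<^bsub>A\<^esub> id b) = GA.cut ?D x \<otimes>\<^bsub>A\<^esub> id b" if "b \<in> carrier B" for b
      unfolding A_def id_apply
    proof (rule GA.cut_mult_right)
      fix y z assume y: "y \<in> carrier G" "b y \<noteq> \<zero>\<^bsub>F\<^esub>" and z: "z \<in> carrier G"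
      then have "y \<in> H" using that B by blast
      then show "z \<otimes>\<^bsub>G\<^esub> y \<in> ?D \<longleftrightarrow> z \<in> ?D"
        using y z ui GA.G.subgroup_mult_right_iff[OF H, of y "u i \<otimes>\<^bsub>G\<^esub> z"]
        by (simp add: GA.G.m_assoc)
    qed (use x that B in \<open>auto simp: A_def\<close>)
    show "GA.cut ?D (id (id c) \<otimes>\<^bsub>A\<^esub> x) = id (id c) \<otimes>\<^bsub>A\<^esub> GA.cut ?D x" if "c \<in> carrier C" for c
      unfolding A_def id_apply
    proof (rule GA.cut_mult_left)
      fix y z assume y: "y \<in> carrier G" "c y \<noteq> \<zero>\<^bsub>F\<^esub>" and z: "z \<in> carrier G"
      then have "y \<in> K" using that C by blast
      \<comment> \<open>Again \<open>y\<close> becomes a conjugate lying in \<open>H\<close>, now to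
        the left of \<open>u i\<close> times \<open>z\<close>.\<close>
      moreover have "u i \<otimes>\<^bsub>G\<^esub> (y \<otimes>\<^bsub>G\<^esub> z)
          = u i \<otimes>\<^bsub>G\<^esub> y \<otimes>\<^bsub>G\<^esub> inv\<^bsub>G\<^esub> u i \<otimes>\<^bsub>G\<^esub> (u i \<otimes>\<^bsub>G\<^esub> z)"
        using y z ui by (simp add: GA.G.m_assoc) (simp flip: GA.G.m_assoc)
      ultimately show "y \<otimes>\<^bsub>G\<^esub> z \<in> ?D \<longleftrightarrow> z \<in> ?D"
        using y z ui conj[OF ui] GA.G.subgroup_mult_left_iff[OF H, of _ "u i \<otimes>\<^bsub>G\<^esub> z"]
        by simp
    qed (use x that C in \<open>auto simp: A_def\<close>)
    have "(GA.delta (u i) \<otimes>\<^bsub>A\<^esub> GA.cut ?D x) z = \<zero>\<^bsub>F\<^esub>" if "z \<notin> H" for z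
    proof (cases "z \<in> carrier G")
      case True
      then show ?thesis
        using x ui that by (simp add: A_def GA.delta_mult_apply) (simp add: GA.cut_def flip: GA.G.m_assoc)
    qed (simp add: A_def GA.mult_outside)
    then show "GA.delta (u i) \<otimes>\<^bsub>A\<^esub> GA.cut ?D x \<in> id ` carrier B"
      using x ui by (simp add: A_def B GA.mult_closed)
  next
    fix x assume x: "x \<in> carrier A"
    have "\<exists>!i. i < n \<and> u i \<otimes>\<^bsub>G\<^esub> y \<in> H" if y: "y \<in> carrier G" for y
    proof -
      \<comment> \<open>Inversion preserves \<open>H\<close> and exchanges left and right cosets, so
        the partition into left cosets follows from that into right cosets at the inverse of
        \<open>y\<close>.\<close>
      have "u i \<otimes>\<^bsub>G\<^esub> y \<in> H \<longleftrightarrow> inv\<^bsub>G\<^esub> y \<otimes>\<^bsub>G\<^esub> inv\<^bsub>G\<^esub> u i \<in> H" if "i < n" for i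
        using u[OF that] y subgroup.m_inv_closed[OF H]
        by (metis GA.G.inv_inv GA.G.inv_mult_group GA.G.m_closed)
      then show ?thesis
        using cosets[of "inv\<^bsub>G\<^esub> y"] y by (metis GA.G.inv_closed)
    qed
    then show "(\<Oplus>\<^bsub>A\<^esub>i\<in>{..<n}. GA.cut {x \<in> carrier G. u i \<otimes>\<^bsub>G\<^esub> x \<in> H} x) = x"
      unfolding A_def using x by (intro GA.finsum_cut) (auto simp: A_def)
  qed (use u in \<open>auto simp: A_def GA.cut_delta unique\<close>)
  ultimately show ?thesis
    using ring_tower_axioms by (simp add: depth_three_def)
qed

end
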